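(* Let $q\ge 1$ be an integer and consider an open necklace of $n$ beads arranged in a line, each bead having a color in $[m]$; let $a_j$ be the number of beads of color $j$ and $r_j$ the remainder of the Euclidean division of $a_j$ by $q$. Suppose $r_j\in\{0,1,q-1\}$ for all $j\in[m]$. Then for every choice, for each $j$ with $r_j\neq 0$, of a set $A_j\subseteq[q]$ of exactly $r_j$ thieves, there exists a fair $q$-splitting of the necklace using at most $(q-1)m$ cuts in which, for each $j$ with $r_j\ne0$, every thief $t\in A_j$ receives $\lceil a_j/q\rceil$ beads of color $j$ and every thief $t\notin A_j$ receives $\lfloor a_j/q\rfloor$ beads of color $j$.
   Context: A $q$-splitting of the necklace with $c$ cuts is obtained by cutting the line of beads at $c$ positions between consecutive beads, producing $c+1$ intervals, and assigning each interval to one of $q$ thieves (identified with $[q]$); each thief receives the beads of the intervals assigned to it. It is fair if for every color $j$ each thief receives $\lfloor a_j/q\rfloor$ or $\lceil a_j/q\rceil$ beads of color $j$. *)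

theory Defs
  imports Complex_Main
begin

(* An open necklace is the list of the colors of its beads. Beads are numbered from 0, and
   a cut at position p lies between the consecutive beads p - 1 and p, so the available
   positions for n beads are {1..<n}. A set C of cuts produces card C + 1 intervals,
   numbered from left to right by 0, ..., card C. *)

definition cut_interval :: "nat \<Rightarrow> nat set \<Rightarrow> nat \<Rightarrow> nat set" where
  "cut_interval n C k = {i. i < n \<and> card {p \<in> C. p \<le> i} = k}"

definition splitting :: "nat \<Rightarrow> nat list \<Rightarrow> nat set \<Rightarrow> (nat \<Rightarrow> nat) \<Rightarrow> bool" where
  "splitting q xs C f \<longleftrightarrow> C \<subseteq> {1..<length xs} \<and> (\<forall>k \<le> card C. f k \<in> {1..q})"

definition beads_received :: "nat list \<Rightarrow> nat set \<Rightarrow> (nat \<Rightarrow> nat) \<Rightarrow> nat \<Rightarrow> nat set" where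
  "beads_received xs C f t = (\<Union>k \<in> {k. k \<le> card C \<and> f k = t}. cut_interval (length xs) C k)"

definition received :: "nat list \<Rightarrow> nat set \<Rightarrow> (nat \<Rightarrow> nat) \<Rightarrow> nat \<Rightarrow> nat \<Rightarrow> nat" where
  "received xs C f t j = card {i \<in> beads_received xs C f t. xs ! i = j}"

definition fair_splitting :: "nat \<Rightarrow> nat \<Rightarrow> nat list \<Rightarrow> nat set \<Rightarrow> (nat \<Rightarrow> nat) \<Rightarrow> bool" where
  "fair_splitting q m xs C f \<longleftrightarrow> splitting q xs C f \<and>
     (\<forall>j \<in> {1..m}. \<forall>t \<in> {1..q}.
        int (received xs C f t j) = \<lfloor>real (count_list xs j) / real q\<rfloor> \<or>
        int (received xs C f t j) = \<lceil>real (count_list xs j) / real q\<rceil>)"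

end

theory Submission
  imports Defs "HOL-Number_Theory.Cong"
begin

text \<open>
  For a prime q, an approximately fair splitting with (q - 1) m cuts comes from the cyclic group
  of order q acting on assignments of beads to thieves. If every assignment with few changes
  gave some thief clearly too much of some color, then choosing such a pair (thief, color)
  equivariantly would label all assignments. Repeated coning off towards a constant assignment
  (resetting longer and longer prefixes) produces chains e_k of k + 1 almost equal assignments with
  at most k changes, where the boundary of e_{k+1} is, up to sign and modulo q, the image of e_k
  under 1 - s or under the sum of all powers of s, alternately, s being the generator of the
  group. Dually, the labels carry alternating cochains linked by the same two operators, since the
  group acts freely on sets of labels in which no color occurs with all q thieves. Pairing the two
  families gives a number that is nonzero modulo q and independent of k up to sign. It vanishes for
  k = (q - 1) m, because the k + 1 labels of such a tuple cannot be distinct.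

  Splitting the parts again extends this to all q. The error does not depend on the necklace,
  so it is negligible once every bead is replaced by many equal beads; Hall's theorem then rounds
  the fractional shares to the prescribed ones. Remainders 0, 1 and q - 1 are exactly what makes
  Hall's condition hold for every choice of the favored thieves.
\<close>

section \<open>Ordered cochains, prism operators and cyclic actions\<close>

text \<open>The coboundary of ordered cochains: the alternating sum over all deletions of one entry,
  with sign plus for the head. The empty list is allowed, so the complex is augmented.\<close>

fun cobd :: "('a list \<Rightarrow> int) \<Rightarrow> 'a list \<Rightarrow> int" where
  "cobd f [] = 0"
| "cobd f (x # xs) = f xs - cobd (\<lambda>ys. f (x # ys)) xs"

lemma cobd_linear:
  "cobd (\<lambda>ys. a * f ys + b * g ys) xs = a * cobd f xs + b * cobd g xs"
  by (induction xs arbitrary: f g) (auto simp: algebra_simps)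

lemma cobd_zero [simp]: "cobd (\<lambda>_. 0) xs = 0"
  by (induction xs) auto

lemma cobd_diff: "cobd (\<lambda>ys. f ys - g ys) xs = cobd f xs - cobd g xs"
  using cobd_linear[of 1 f "-1" g xs] by simp

lemma cobd_add: "cobd (\<lambda>ys. f ys + g ys) xs = cobd f xs + cobd g xs"
  using cobd_linear[of 1 f 1 g xs] by simp

lemma cobd_minus: "cobd (\<lambda>ys. - f ys) xs = - cobd f xs"
  using cobd_linear[of "-1" f 0 f xs] by simp

lemma cobd_sum:
  "finite I \<Longrightarrow> cobd (\<lambda>ys. \<Sum>i\<in>I. f i ys) xs = (\<Sum>i\<in>I. cobd (f i) xs)"
  by (induction I rule: finite_induct) (auto simp: cobd_add)

lemma cobd_map: "cobd f (map h xs) = cobd (\<lambda>ys. f (map h ys)) xs"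
  by (induction xs arbitrary: f) auto

lemma cobd_cobd [simp]: "cobd (cobd f) xs = 0"
  by (induction xs arbitrary: f) (auto simp: cobd_diff)

lemma cobd_cong:
  assumes "\<And>ys. set ys \<subseteq> set xs \<Longrightarrow> f ys = g ys"
  shows "cobd f xs = cobd g xs"
  using assms
proof (induction xs arbitrary: f g)
  case (Cons x xs)
  have "cobd (\<lambda>ys. f (x # ys)) xs = cobd (\<lambda>ys. g (x # ys)) xs"
  proof (rule Cons.IH)
    show "f (x # ys) = g (x # ys)" if "set ys \<subseteq> set xs" for ys
      by (rule Cons.prems) (use that in auto)
  qed
  moreover have "f xs = g xs"
    by (rule Cons.prems) auto
  ultimately show ?case by simp
qed simp

definition alternating :: "('a list \<Rightarrow> int) \<Rightarrow> bool" where
  "alternating f \<longleftrightarrow> (\<forall>us a b vs. f (us @ a # b # vs) = - f (us @ b # a # vs))"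

text \<open>Deleting \<open>a\<close> before the swap and deleting it after the swap leave the same
  list but carry opposite signs, and likewise for \<open>b\<close>. All other terms change sign
  because \<open>f\<close> does.\<close>

lemma alternating_cobd:
  assumes "alternating f"
  shows "alternating (cobd f)"
proof -
  have "cobd f (us @ a # b # vs) = - cobd f (us @ b # a # vs)"
    if "\<And>us a b vs. f (us @ a # b # vs) = - f (us @ b # a # vs)"
    for us a b vs and f :: "'a list \<Rightarrow> int"
    using that
  proof (induction us arbitrary: f)
    case Nil
    have "(\<lambda>ys. f (a # b # ys)) = (\<lambda>ys. - f (b # a # ys))"
      by (rule ext, rule Nil[of "[]", unfolded append_Nil])
    then show ?case
      using Nil[of "[]" a b vs] by (simp add: cobd_minus)
  next
    case (Cons x us)
    have "cobd (\<lambda>ys. f (x # ys)) (us @ a # b # vs) = - cobd (\<lambda>ys. f (x # ys)) (us @ b # a # vs)"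
      by (rule Cons.IH) (metis Cons.prems append_Cons)
    then show ?case
      using Cons.prems[of us a b vs] by simp
  qed
  then show ?thesis
    using assms unfolding alternating_def by blast
qed

text \<open>Adjacent swaps bring two equal entries together. Swapping these gives a value equal to
  its own negative, hence zero over the integers.\<close>

lemma alternating_not_distinct:
  assumes alt: "alternating f" and nd: "\<not> distinct xs"
  shows "f xs = 0"
proof -
  have "f (us @ y # vs @ y # ws) = 0" for us y vs ws
  proof (induction vs arbitrary: us)
    case Nil
    then show ?case
      using alt unfolding alternating_def by (metis append_Nil neg_equal_zero)
  next
    case (Cons v vs)
    have "f (us @ y # v # vs @ y # ws) = - f (us @ v # y # vs @ y # ws)"
      using alt unfolding alternating_def by blast
    also have "f (us @ v # y # vs @ y # ws) = 0"
      using Cons.IH[of "us @ [v]"] by simp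
    finally show ?case by simp
  qed
  then show ?thesis
    using not_distinct_decomp[OF nd] by auto
qed

text \<open>The classical prism operator in recursive form: an alternating sum over \<open>i\<close>
  of \<open>f\<close> at the list that takes images under \<open>g\<close> up to the
  \<open>i\<close>-th entry and images under \<open>h\<close> from the \<open>i\<close>-th entry on,
  so that this entry is used twice.\<close>

fun prism :: "('a \<Rightarrow> 'b) \<Rightarrow> ('a \<Rightarrow> 'b) \<Rightarrow> ('b list \<Rightarrow> int) \<Rightarrow> 'a list \<Rightarrow> int" where
  "prism g h f [] = 0"
| "prism g h f (x # xs) = f (g x # h x # map h xs) - prism g h (\<lambda>ys. f (g x # ys)) xs"

lemma prism_linear:
  "prism g h (\<lambda>ys. a * f ys + b * k ys) xs = a * prism g h f xs + b * prism g h k xs"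
  by (induction xs arbitrary: f k) (auto simp: algebra_simps)

lemma prism_diff: "prism g h (\<lambda>ys. f ys - k ys) xs = prism g h f xs - prism g h k xs"
  using prism_linear[of g h 1 f "-1" k xs] by simp

text \<open>Needed because the later identities between cochains hold only on lists whose words are
  close to each other.\<close>

lemma prism_cong:
  assumes "\<And>ys. set ys \<subseteq> g ` set xs \<union> h ` set xs \<Longrightarrow> length ys = Suc (length xs) \<Longrightarrow> f ys = k ys"
  shows "prism g h f xs = prism g h k xs"
  using assms
proof (induction xs arbitrary: f k)
  case (Cons x xs)
  have "prism g h (\<lambda>ys. f (g x # ys)) xs = prism g h (\<lambda>ys. k (g x # ys)) xs"
    by (rule Cons.IH) (rule Cons.prems, auto)
  moreover have "f (g x # h x # map h xs) = k (g x # h x # map h xs)"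
    by (rule Cons.prems) auto
  ultimately show ?case by simp
qed simp

text \<open>The mixed terms cancel in pairs, leaving the pullbacks along \<open>h\<close> and
  \<open>g\<close>. The induction absorbs the image of the head under \<open>g\<close> into the
  cochain.\<close>

lemma prism_homotopy:
  "cobd (prism g h f) xs + prism g h (cobd f) xs = f (map h xs) - f (map g xs)"
proof (induction xs arbitrary: f)
  case (Cons x xs)
  show ?case
    using Cons.IH[of "\<lambda>ys. f (g x # ys)"]
    by (simp add: cobd_diff prism_diff cobd_map)
qed simp

text \<open>This and \<open>cyc_diff\<close> are the norm and the factor \<open>1 - s\<close> of a
  cyclic group, acting by pullback. For an action of order \<open>p\<close> their composites vanish,
  which is why the later recursions alternate between them.\<close>

definition cyc_sum :: "nat \<Rightarrow> ('a \<Rightarrow> 'a) \<Rightarrow> ('a list \<Rightarrow> int) \<Rightarrow> 'a list \<Rightarrow> int" where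
  "cyc_sum p s f xs = (\<Sum>i<p. f (map (s ^^ i) xs))"

definition cyc_diff :: "('a \<Rightarrow> 'a) \<Rightarrow> ('a list \<Rightarrow> int) \<Rightarrow> 'a list \<Rightarrow> int" where
  "cyc_diff s f xs = f xs - f (map s xs)"

lemma cobd_cyc_sum: "cobd (cyc_sum p s f) xs = cyc_sum p s (cobd f) xs"
  unfolding cyc_sum_def by (simp add: cobd_sum cobd_map)

lemma cobd_cyc_diff: "cobd (cyc_diff s f) xs = cyc_diff s (cobd f) xs"
  unfolding cyc_diff_def by (simp add: cobd_diff cobd_map)

section \<open>Equivariant cochains on sets of labels\<close>

definition rot :: "nat \<Rightarrow> nat \<times> nat \<Rightarrow> nat \<times> nat" where
  "rot p l = (Suc (fst l) mod p, snd l)"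

definition fiber :: "(nat \<times> nat) set \<Rightarrow> nat set" where
  "fiber X = {s. (s, LEAST j. \<exists>s. (s, j) \<in> X) \<in> X}"

text \<open>The mean of the first nonempty fiber modulo p, so that the rotation increases it by one.
  Only for proper fibers and prime p is the cardinality of the fiber invertible.\<close>

definition phase :: "nat \<Rightarrow> (nat \<times> nat) set \<Rightarrow> nat" where
  "phase p X = (\<Sum>(fiber X) * (SOME v. [card (fiber X) * v = 1] (mod p))) mod p"

text \<open>These label sets form a simplicial complex, and for prime \<open>p\<close> the rotation
  acts freely on its nonempty finite members.\<close>

definition proper_fibers :: "nat \<Rightarrow> (nat \<times> nat) set \<Rightarrow> bool" where
  "proper_fibers p X \<longleftrightarrow> X \<subseteq> {..<p} \<times> UNIV \<and> (\<forall>j. \<exists>s<p. (s, j) \<notin> X)"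

lemma proper_fibers_subset: "proper_fibers p X \<Longrightarrow> Y \<subseteq> X \<Longrightarrow> proper_fibers p Y"
  unfolding proper_fibers_def by blast

lemma Suc_mod_inj: "x < p \<Longrightarrow> y < p \<Longrightarrow> Suc x mod p = Suc y mod p \<Longrightarrow> x = (y::nat)"
  by (auto simp: mod_Suc split: if_splits)

lemma proper_fibers_rot:
  assumes p: "0 < p" and "proper_fibers p X"
  shows "proper_fibers p (rot p ` X)"
  unfolding proper_fibers_def
proof (intro conjI allI)
  show "rot p ` X \<subseteq> {..<p} \<times> UNIV"
    using p by (auto simp: rot_def)
  fix j
  obtain s where "s < p" "(s, j) \<notin> X"
    using assms(2) unfolding proper_fibers_def by blast
  moreover have "X \<subseteq> {..<p} \<times> UNIV"
    using assms(2) unfolding proper_fibers_def by blast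
  ultimately have "(Suc s mod p, j) \<notin> rot p ` X"
    by (auto simp: rot_def dest!: Suc_mod_inj)
  then show "\<exists>s<p. (s, j) \<notin> rot p ` X"
    using p by (intro exI[of _ "Suc s mod p"]) auto
qed

lemma fiber_rot: "fiber (rot p ` X) = (\<lambda>s. Suc s mod p) ` fiber X"
proof -
  have "(\<exists>s. (s, j) \<in> rot p ` X) \<longleftrightarrow> (\<exists>s. (s, j) \<in> X)" for j
    by (force simp: rot_def)
  then show ?thesis
    unfolding fiber_def by (force simp: rot_def)
qed

text \<open>Adding one modulo \<open>p\<close> to every member raises the sum of the fiber by its
  cardinality. Multiplication by the inverse of the cardinality turns this increase into
  one.\<close>

lemma phase_rot:
  assumes p: "prime p" and X: "proper_fibers p X" "X \<noteq> {}"
  shows "phase p (rot p ` X) = Suc (phase p X) mod p"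
proof -
  let ?F = "fiber X"
  let ?v = "SOME v. [card ?F * v = 1] (mod p)"
  define j where "j = (LEAST j. \<exists>s. (s, j) \<in> X)"
  have "\<exists>j s. (s, j) \<in> X"
    using X(2) by auto
  then have "\<exists>s. (s, j) \<in> X"
    unfolding j_def by (rule LeastI_ex)
  then have ne: "?F \<noteq> {}"
    unfolding fiber_def j_def by blast
  have sub: "?F \<subseteq> {..<p}"
    using X(1) unfolding proper_fibers_def fiber_def by auto
  have "\<exists>s<p. s \<notin> ?F"
    using X(1) unfolding proper_fibers_def fiber_def by blast
  with sub have "?F \<subset> {..<p}"
    by blast
  then have "card ?F < p"
    using psubset_card_mono[of "{..<p}" ?F] by simp
  moreover have fin: "finite ?F"
    using sub finite_subset by blast
  then have "0 < card ?F"
    using ne by (simp add: card_gt_0_iff)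
  ultimately have "coprime (card ?F) p"
    using p by (metis coprime_commute nat_dvd_not_less prime_imp_coprime)
  then have "\<exists>v. [card ?F * v = 1] (mod p)"
    using cong_solve_coprime_nat by auto
  then have v: "[card ?F * ?v = 1] (mod p)"
    by (rule someI_ex)
  have inj: "inj_on (\<lambda>s. Suc s mod p) ?F"
    using sub by (auto simp: inj_on_def intro: Suc_mod_inj)
  have "[\<Sum>(fiber (rot p ` X)) = \<Sum>?F + card ?F] (mod p)"
  proof -
    have "\<Sum>(fiber (rot p ` X)) = (\<Sum>s\<in>?F. Suc s mod p)"
      using inj by (simp add: fiber_rot sum.reindex)
    also have "[\<dots> = (\<Sum>s\<in>?F. s + 1)] (mod p)"
      by (rule cong_sum) (simp add: cong_def)
    also have "(\<Sum>s\<in>?F. s + 1) = \<Sum>?F + card ?F"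
      by (subst sum.distrib) simp
    finally show ?thesis .
  qed
  then have "[\<Sum>(fiber (rot p ` X)) * ?v = (\<Sum>?F + card ?F) * ?v] (mod p)"
    by (rule cong_scalar_right)
  also have "(\<Sum>?F + card ?F) * ?v = \<Sum>?F * ?v + card ?F * ?v"
    by (simp add: algebra_simps)
  also have "[\<dots> = \<Sum>?F * ?v + 1] (mod p)"
    by (intro cong_add v) simp
  finally have "[\<Sum>(fiber (rot p ` X)) * ?v = \<Sum>?F * ?v + 1] (mod p)" .
  moreover have "card (fiber (rot p ` X)) = card ?F"
    using inj by (simp add: fiber_rot card_image)
  ultimately show ?thesis
    unfolding phase_def by (simp add: cong_def mod_Suc_eq)
qed

lemma phase_less: "0 < p \<Longrightarrow> phase p X < p"
  unfolding phase_def by simp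

lemma rot_funpow: "fst l < p \<Longrightarrow> (rot p ^^ i) l = ((fst l + i) mod p, snd l)"
  by (induction i) (auto simp: rot_def mod_Suc_eq)

lemma proper_fibers_rot_funpow:
  "0 < p \<Longrightarrow> proper_fibers p X \<Longrightarrow> proper_fibers p ((rot p ^^ i) ` X)"
proof (induction i)
  case (Suc i)
  have "(rot p ^^ Suc i) ` X = rot p ` ((rot p ^^ i) ` X)"
    by (auto simp: image_comp)
  then show ?case
    using Suc proper_fibers_rot by simp
qed simp

lemma phase_rot_funpow:
  assumes "prime p" "proper_fibers p X" "X \<noteq> {}"
  shows "phase p ((rot p ^^ i) ` X) = (phase p X + i) mod p"
proof (induction i)
  case 0
  then show ?case
    using phase_less prime_gt_0_nat[OF assms(1)] by simp
next
  case (Suc i)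
  have "(rot p ^^ Suc i) ` X = rot p ` ((rot p ^^ i) ` X)"
    by (auto simp: image_comp)
  then show ?case
    using Suc phase_rot[of p "(rot p ^^ i) ` X"] assms proper_fibers_rot_funpow prime_gt_0_nat
    by (simp add: mod_Suc_eq)
qed

text \<open>Each cochain solves the equation given in label_cochain_step: the phase singles out one
  member of every orbit, from which the solution is defined along the orbit.\<close>

fun label_cochain :: "nat \<Rightarrow> nat \<Rightarrow> (nat \<times> nat) list \<Rightarrow> int" where
  "label_cochain p 0 xs = (if xs = [] then 1 else 0)"
| "label_cochain p (Suc k) xs =
    (if even k then (if phase p (set xs) = 0 then cobd (label_cochain p k) xs else 0)
     else (\<Sum>i < p - phase p (set xs). cobd (label_cochain p k) (map (rot p ^^ i) xs)))"

lemma alternating_label_cochain: "alternating (label_cochain p k)"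
proof (induction k)
  case 0
  then show ?case by (simp add: alternating_def)
next
  case (Suc k)
  show ?case
    unfolding alternating_def
  proof (intro allI)
    fix us vs :: "(nat \<times> nat) list" and a b
    have "cobd (label_cochain p k) (map h (us @ a # b # vs))
        = - cobd (label_cochain p k) (map h (us @ b # a # vs))" for h
      using alternating_cobd[OF Suc] unfolding alternating_def map_append list.map by blast
    from this[of id] this have "cobd (label_cochain p k) (us @ a # b # vs)
        = - cobd (label_cochain p k) (us @ b # a # vs)"
      "(\<Sum>i<m. cobd (label_cochain p k) (map (rot p ^^ i) (us @ a # b # vs)))
        = - (\<Sum>i<m. cobd (label_cochain p k) (map (rot p ^^ i) (us @ b # a # vs)))" for m
      by (simp_all only: list.map_id sum_negf)
    moreover have "set (us @ a # b # vs) = set (us @ b # a # vs)"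
      by auto
    ultimately show "label_cochain p (Suc k) (us @ a # b # vs) = - label_cochain p (Suc k) (us @ b # a # vs)"
      unfolding label_cochain.simps
      by (cases "even k"; cases "phase p (set (us @ b # a # vs)) = 0";
          simp only: simp_thms if_True if_False minus_zero)
  qed
qed

text \<open>The first two claims are the solvability conditions for the last two. They pass from
  \<open>k\<close> to \<open>Suc k\<close> by applying \<open>cobd\<close> to the equation just
  solved, since \<open>cobd\<close> commutes with both operators and has square zero.\<close>

lemma label_cochain_step:
  assumes p: "prime p"
  defines "d \<equiv> \<lambda>k. cobd (label_cochain p k)"
  shows "proper_fibers p (set xs) \<Longrightarrow> even k \<Longrightarrow> cyc_diff (rot p) (d k) xs = 0"
    and "proper_fibers p (set xs) \<Longrightarrow> odd k \<Longrightarrow> cyc_sum p (rot p) (d k) xs = 0"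
    and "proper_fibers p (set xs) \<Longrightarrow> even k \<Longrightarrow> cyc_sum p (rot p) (label_cochain p (Suc k)) xs = d k xs"
    and "proper_fibers p (set xs) \<Longrightarrow> odd k \<Longrightarrow> cyc_diff (rot p) (label_cochain p (Suc k)) xs = d k xs"
proof -
  have p0: "0 < p"
    using p by (rule prime_gt_0_nat)
  have from_inv: "cyc_sum p (rot p) (label_cochain p (Suc k)) xs = d k xs"
    if k: "even k" and inv: "\<And>xs. proper_fibers p (set xs) \<Longrightarrow> cyc_diff (rot p) (d k) xs = 0"
      and xs: "proper_fibers p (set xs)" for k xs
  \<comment> \<open>The empty list has no phase that a rotation could raise, but both sides vanish
    there.\<close>
  proof (cases "xs = []")
    case True
    then show ?thesis using k by (simp add: cyc_sum_def d_def)
  next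
    case False
    have const: "d k (map (rot p ^^ i) xs) = d k xs" for i
    proof (induction i)
      case (Suc i)
      have "cyc_diff (rot p) (d k) (map (rot p ^^ i) xs) = 0"
        by (rule inv) (use proper_fibers_rot_funpow[OF p0 xs] in simp)
      then show ?case
        using Suc by (simp add: cyc_diff_def o_def)
    qed simp
    define c where "c = phase p (set xs)"
    have c: "c < p"
      unfolding c_def using p0 by (rule phase_less)
    \<comment> \<open>Exactly one of the \<open>p\<close> rotations has phase 0, so a single summand
      survives, and it equals \<open>d k xs\<close> by invariance.\<close>
    have "cyc_sum p (rot p) (label_cochain p (Suc k)) xs
        = (\<Sum>i<p. if (c + i) mod p = 0 then d k xs else 0)"
      unfolding cyc_sum_def
    proof (rule sum.cong)
      fix i
      show "label_cochain p (Suc k) (map (rot p ^^ i) xs) = (if (c + i) mod p = 0 then d k xs else 0)"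
        using k const[of i] phase_rot_funpow[OF p xs, of i] False by (simp add: c_def d_def)
    qed simp
    also have "\<dots> = (\<Sum>i<p. if i = (p - c) mod p then d k xs else 0)"
    proof (intro sum.cong if_cong refl)
      fix i assume i: "i \<in> {..<p}"
      show "(c + i) mod p = 0 \<longleftrightarrow> i = (p - c) mod p"
      proof (cases "c + i < p")
        case True
        then show ?thesis using i c by (cases "c = 0") auto
      next
        case False
        then have "(c + i) mod p = c + i - p"
          using i c by (simp add: mod_if)
        then show ?thesis using False i c by (cases "c = 0") auto
      qed
    qed
    also have "\<dots> = d k xs"
      using p0 by (simp add: sum.delta)
    finally show ?thesis .
  qed
  have from_sum: "cyc_diff (rot p) (label_cochain p (Suc k)) xs = d k xs"
    if k: "odd k" and inv: "\<And>xs. proper_fibers p (set xs) \<Longrightarrow> cyc_sum p (rot p) (d k) xs = 0"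
      and xs: "proper_fibers p (set xs)" for k xs
  proof (cases "xs = []")
    case True
    then show ?thesis using k by (simp add: cyc_diff_def d_def)
  next
    case False
    define c where "c = phase p (set xs)"
    have c: "c < p"
      unfolding c_def using p0 by (rule phase_less)
    let ?a = "\<lambda>i. d k (map (rot p ^^ i) xs)"
    have 1: "label_cochain p (Suc k) xs = (\<Sum>i<p - c. ?a i)"
      using k by (simp add: c_def d_def)
    have "map (rot p ^^ i) (map (rot p) xs) = map (rot p ^^ Suc i) xs" for i
      by (simp add: funpow_Suc_right del: funpow.simps)
    then have 2: "label_cochain p (Suc k) (map (rot p) xs) = (\<Sum>i < p - Suc c mod p. ?a (Suc i))"
      using k phase_rot[OF p xs] False by (simp add: c_def d_def del: map_map funpow.simps)
    show ?thesis
    \<comment> \<open>The two partial orbit sums differ by the first summand of the one for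
      \<open>xs\<close>. If the phase wraps around, the sum for the rotated list is instead a full
      orbit sum, which vanishes by \<open>inv\<close>.\<close>
    proof (cases "Suc c = p")
      case True
      have "(\<Sum>i<p. ?a i) = 0"
        using inv[OF xs] by (simp add: cyc_sum_def)
      moreover have "(\<Sum>i<p. ?a (Suc i)) = (\<Sum>i<p. ?a i) + ?a p - ?a 0"
        using sum.lessThan_Suc_shift[of ?a p] sum.lessThan_Suc[of ?a p] by simp
      moreover have "map (rot p ^^ p) xs = xs"
        using xs unfolding proper_fibers_def by (intro map_idI) (auto simp: rot_funpow)
      ultimately have "(\<Sum>i<p. ?a (Suc i)) = 0"
        by simp
      moreover have "p - c = 1"
        using True by simp
      ultimately show ?thesis
        unfolding cyc_diff_def 1 2 using True by simp
    next
      case ne: False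
      then have "p - c = Suc (p - Suc c mod p)"
        using c by auto
      then show ?thesis
        unfolding cyc_diff_def 1 2 by (simp only: sum.lessThan_Suc_shift) simp
    qed
  qed
  have inv: "(even k \<longrightarrow> (\<forall>xs. proper_fibers p (set xs) \<longrightarrow> cyc_diff (rot p) (d k) xs = 0)) \<and>
      (odd k \<longrightarrow> (\<forall>xs. proper_fibers p (set xs) \<longrightarrow> cyc_sum p (rot p) (d k) xs = 0))" for k
  proof (induction k)
    case 0
    have "cyc_diff (rot p) (label_cochain p 0) = (\<lambda>_. 0)"
      by (auto simp: cyc_diff_def)
    then have "cyc_diff (rot p) (d 0) xs = 0" for xs
      unfolding d_def using cobd_cyc_diff[of "rot p" "label_cochain p 0" xs] by (simp del: label_cochain.simps)
    then show ?case by simp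
  next
    case (Suc k)
    show ?case
    proof (cases "even k")
      case True
      have "cyc_sum p (rot p) (d (Suc k)) xs = 0" if xs: "proper_fibers p (set xs)" for xs
      proof -
        have "cyc_sum p (rot p) (d (Suc k)) xs = cobd (cyc_sum p (rot p) (label_cochain p (Suc k))) xs"
          unfolding d_def by (rule cobd_cyc_sum[symmetric])
        also have "\<dots> = cobd (d k) xs"
          by (rule cobd_cong, rule from_inv) (use True Suc xs proper_fibers_subset in auto)
        finally show ?thesis by (simp add: d_def)
      qed
      then show ?thesis using True by simp
    next
      case False
      have "cyc_diff (rot p) (d (Suc k)) xs = 0" if xs: "proper_fibers p (set xs)" for xs
      proof -
        have "cyc_diff (rot p) (d (Suc k)) xs = cobd (cyc_diff (rot p) (label_cochain p (Suc k))) xs"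
          unfolding d_def by (rule cobd_cyc_diff[symmetric])
        also have "\<dots> = cobd (d k) xs"
          by (rule cobd_cong, rule from_sum) (use False Suc xs proper_fibers_subset in auto)
        finally show ?thesis by (simp add: d_def)
      qed
      then show ?thesis using False by simp
    qed
  qed
  show "proper_fibers p (set xs) \<Longrightarrow> even k \<Longrightarrow> cyc_diff (rot p) (d k) xs = 0"
    and "proper_fibers p (set xs) \<Longrightarrow> odd k \<Longrightarrow> cyc_sum p (rot p) (d k) xs = 0"
    using inv by blast+
  show "proper_fibers p (set xs) \<Longrightarrow> even k \<Longrightarrow> cyc_sum p (rot p) (label_cochain p (Suc k)) xs = d k xs"
    by (rule from_inv) (use inv in blast)+
  show "proper_fibers p (set xs) \<Longrightarrow> odd k \<Longrightarrow> cyc_diff (rot p) (label_cochain p (Suc k)) xs = d k xs"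
    by (rule from_sum) (use inv in blast)+
qed

section \<open>Chains of assignments\<close>

text \<open>The number of cuts that realize an assignment \<open>w\<close> of beads to
  thieves.\<close>

definition changes :: "'a list \<Rightarrow> nat" where
  "changes w = card {i. Suc i < length w \<and> w ! i \<noteq> w ! Suc i}"

lemma changes_replicate [simp]: "changes (replicate n x) = 0"
proof -
  have "{i. Suc i < n \<and> replicate n x ! i \<noteq> replicate n x ! Suc i} = {}"
    by auto
  then show ?thesis
    by (simp only: changes_def length_replicate card.empty)
qed

definition words :: "nat \<Rightarrow> nat \<Rightarrow> nat list set" where
  "words p n = {w. length w = n \<and> set w \<subseteq> {..<p}}"

definition shift :: "nat \<Rightarrow> nat list \<Rightarrow> nat list" where
  "shift p w = map (\<lambda>x. Suc x mod p) w"

definition reset :: "nat \<Rightarrow> nat list \<Rightarrow> nat list" where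
  "reset t w = replicate t 0 @ drop t w"

text \<open>One number bounds both quantities because each coning step costs one more change and one
  more bead of disagreement. The bound on disagreement later compares the shares of a thief in
  different words of the same set.\<close>

definition near :: "nat \<Rightarrow> nat \<Rightarrow> nat \<Rightarrow> nat list set \<Rightarrow> bool" where
  "near p n k X \<longleftrightarrow> X \<subseteq> words p n \<and> (\<forall>w\<in>X. changes w \<le> k) \<and>
     (\<exists>D. finite D \<and> card D \<le> k \<and> (\<forall>v\<in>X. \<forall>w\<in>X. \<forall>i<n. i \<notin> D \<longrightarrow> v ! i = w ! i))"

lemma near_subset: "near p n k X \<Longrightarrow> Y \<subseteq> X \<Longrightarrow> near p n k Y"
  unfolding near_def by (meson subset_iff)

lemma near_mono: "near p n k X \<Longrightarrow> k \<le> l \<Longrightarrow> near p n l X"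
  unfolding near_def by (meson le_trans)

lemma nth_words: "w \<in> words p n \<Longrightarrow> i < n \<Longrightarrow> w ! i < p"
  unfolding words_def by (auto simp: subset_iff)

lemma length_words: "w \<in> words p n \<Longrightarrow> length w = n"
  unfolding words_def by simp

lemma shift_words: "0 < p \<Longrightarrow> w \<in> words p n \<Longrightarrow> shift p w \<in> words p n"
  unfolding words_def shift_def by auto

lemma changes_shift: "w \<in> words p n \<Longrightarrow> changes (shift p w) = changes w"
proof -
  assume w: "w \<in> words p n"
  have "shift p w ! i \<noteq> shift p w ! Suc i \<longleftrightarrow> w ! i \<noteq> w ! Suc i" if "Suc i < length w" for i
    using that Suc_mod_inj[OF nth_words[OF w, of i] nth_words[OF w, of "Suc i"]] length_words[OF w]
    by (auto simp: shift_def)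
  then show ?thesis
    unfolding changes_def by (intro arg_cong[of _ _ card] Collect_cong) (auto simp: shift_def)
qed

lemma shift_funpow: "w \<in> words p n \<Longrightarrow> (shift p ^^ i) w = map (\<lambda>x. (x + i) mod p) w"
proof (induction i)
  case 0
  then show ?case by (auto simp: words_def subset_iff intro!: map_idI[symmetric])
next
  case (Suc i)
  then show ?case by (simp add: shift_def mod_Suc_eq)
qed

lemma shift_funpow_period: "w \<in> words p n \<Longrightarrow> (shift p ^^ p) w = w"
  by (subst shift_funpow) (auto simp: words_def subset_iff intro!: map_idI)

lemma near_shift:
  assumes "0 < p" "near p n k X"
  shows "near p n k (shift p ` X)"
proof -
  obtain D where D: "finite D" "card D \<le> k" "\<forall>v\<in>X. \<forall>w\<in>X. \<forall>i<n. i \<notin> D \<longrightarrow> v ! i = w ! i"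
    using assms unfolding near_def by blast
  have X: "X \<subseteq> words p n" "\<forall>w\<in>X. changes w \<le> k"
    using assms unfolding near_def by auto
  show ?thesis
    unfolding near_def
  proof (intro conjI exI[of _ D] D(1,2))
    show "shift p ` X \<subseteq> words p n"
      using X(1) shift_words[OF assms(1)] by blast
    show "\<forall>w\<in>shift p ` X. changes w \<le> k"
      using X changes_shift by (metis (no_types, lifting) imageE subsetD)
    have "shift p v ! i = shift p w ! i" if "v \<in> X" "w \<in> X" "i < n" "i \<notin> D" for v w i
    proof -
      have "v ! i = w ! i" "length v = n" "length w = n"
        using D(3) that X(1) length_words by blast+
      then show ?thesis
        using that(3) by (simp add: shift_def)
    qed
    then show "\<forall>v\<in>shift p ` X. \<forall>w\<in>shift p ` X. \<forall>i<n. i \<notin> D \<longrightarrow> v ! i = w ! i"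
      by blast
  qed
qed

lemma near_shift_funpow: "0 < p \<Longrightarrow> near p n k X \<Longrightarrow> near p n k ((shift p ^^ i) ` X)"
proof (induction i)
  case (Suc i)
  have "(shift p ^^ Suc i) ` X = shift p ` ((shift p ^^ i) ` X)"
    by (auto simp: image_comp)
  then show ?case
    using Suc near_shift by simp
qed simp

lemma nth_reset: "t \<le> length w \<Longrightarrow> i < length w \<Longrightarrow> reset t w ! i = (if i < t then 0 else w ! i)"
  unfolding reset_def by (auto simp: nth_append)

lemma reset_words: "0 < p \<Longrightarrow> t \<le> n \<Longrightarrow> w \<in> words p n \<Longrightarrow> reset t w \<in> words p n"
  unfolding words_def reset_def by (auto dest: in_set_dropD)

text \<open>A new change can only arise at the end of the prefix, between the beads
  \<open>t - 1\<close> and \<open>t\<close>.\<close>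

lemma changes_reset:
  assumes "t \<le> length w"
  shows "changes (reset t w) \<le> Suc (changes w)"
proof -
  let ?A = "\<lambda>w. {i. Suc i < length w \<and> w ! i \<noteq> w ! Suc i}"
  have len: "length (reset t w) = length w"
    using assms by (simp add: reset_def)
  have "?A (reset t w) \<subseteq> insert (t - 1) (?A w)"
  proof
    fix i assume "i \<in> ?A (reset t w)"
    then show "i \<in> insert (t - 1) (?A w)"
      using assms by (auto simp: len nth_reset split: if_splits)
  qed
  moreover have "finite (?A w)"
    by (rule finite_subset[of _ "{..<length w}"]) auto
  ultimately have "card (?A (reset t w)) \<le> card (insert (t - 1) (?A w))"
    by (intro card_mono) auto
  also have "\<dots> \<le> Suc (card (?A w))"
    by (rule card_insert_le_m1) auto
  finally show ?thesis
    unfolding changes_def .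
qed

text \<open>Beads before \<open>t\<close> all go to thief 0 and beads after \<open>t\<close> are
  untouched, so \<open>t\<close> is the only new place of disagreement.\<close>

lemma near_reset:
  assumes p: "0 < p" and t: "t < n" and near: "near p n k X"
  shows "near p n (Suc k) (reset t ` X \<union> reset (Suc t) ` X)"
proof -
  obtain D where D: "finite D" "card D \<le> k" "\<forall>v\<in>X. \<forall>w\<in>X. \<forall>i<n. i \<notin> D \<longrightarrow> v ! i = w ! i"
    using near unfolding near_def by blast
  have X: "X \<subseteq> words p n" "\<forall>w\<in>X. changes w \<le> k"
    using near unfolding near_def by auto
  then have len: "length w = n" if "w \<in> X" for w
    using that length_words by blast
  show ?thesis
    unfolding near_def
  proof (intro conjI exI[of _ "insert t D"])
    show "reset t ` X \<union> reset (Suc t) ` X \<subseteq> words p n"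
      using X(1) p t reset_words by (auto simp: subset_iff)
    show "\<forall>w\<in>reset t ` X \<union> reset (Suc t) ` X. changes w \<le> Suc k"
    proof
      fix w assume "w \<in> reset t ` X \<union> reset (Suc t) ` X"
      then obtain v s where "v \<in> X" "w = reset s v" "s \<le> n"
        using t by auto
      then show "changes w \<le> Suc k"
        using changes_reset[of s v] X(2) len by fastforce
    qed
    show "finite (insert t D)"
      using D by simp
    show "card (insert t D) \<le> Suc k"
      using D card_insert_le_m1[of "Suc k" D t] by simp
    have "reset r v ! i = reset s w ! i"
      if "v \<in> X" "w \<in> X" "r \<in> {t, Suc t}" "s \<in> {t, Suc t}" "i < n" "i \<notin> insert t D" for v w r s i
    proof -
      have "v ! i = w ! i"
        using D(3) that by blast
      moreover have "r \<le> n" "s \<le> n" "i < r \<longleftrightarrow> i < s"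
        using that(3,4,6) t by auto
      ultimately show ?thesis
        using that(5) by (simp add: nth_reset len[OF that(1)] len[OF that(2)])
    qed
    note agree = this
    show "\<forall>v\<in>reset t ` X \<union> reset (Suc t) ` X. \<forall>w\<in>reset t ` X \<union> reset (Suc t) ` X.
        \<forall>i<n. i \<notin> insert t D \<longrightarrow> v ! i = w ! i"
    proof (intro ballI allI impI)
      fix v' w' i
      assume v': "v' \<in> reset t ` X \<union> reset (Suc t) ` X"
        and w': "w' \<in> reset t ` X \<union> reset (Suc t) ` X"
        and i: "i < n" "i \<notin> insert t D"
      obtain v r where v: "v \<in> X" "r \<in> {t, Suc t}" "v' = reset r v"
        using v' by blast
      obtain w s where w: "w \<in> X" "s \<in> {t, Suc t}" "w' = reset s w"
        using w' by blast
      show "v' ! i = w' ! i"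
        unfolding v(3) w(3) by (rule agree[OF v(1) w(1) v(2) w(2) i])
    qed
  qed
qed

text \<open>The homotopy from the identity \<open>reset 0\<close> to the constant map
  \<open>reset n\<close>, cut into \<open>n\<close> prisms that move one bead each. A single prism
  would put words that differ in many beads into one list.\<close>

definition contraction :: "nat \<Rightarrow> (nat list list \<Rightarrow> int) \<Rightarrow> nat list list \<Rightarrow> int" where
  "contraction n f xs = (\<Sum>t<n. prism (reset t) (reset (Suc t)) f xs)"

definition twist :: "nat \<Rightarrow> nat \<Rightarrow> (nat list list \<Rightarrow> int) \<Rightarrow> nat list list \<Rightarrow> int" where
  "twist p k = (if even k then cyc_diff (shift p) else cyc_sum p (shift p))"

text \<open>Evaluation of a cochain on the chain obtained from the constant assignment by k times
  applying twist and then coning off.\<close>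

fun eval_chain :: "nat \<Rightarrow> nat \<Rightarrow> nat \<Rightarrow> (nat list list \<Rightarrow> int) \<Rightarrow> int" where
  "eval_chain p n 0 f = f [replicate n 0]"
| "eval_chain p n (Suc k) f = eval_chain p n k (twist p k (contraction n f))"

lemma contraction_linear:
  "contraction n (\<lambda>ys. a * f ys + b * g ys) = (\<lambda>xs. a * contraction n f xs + b * contraction n g xs)"
  unfolding contraction_def by (simp add: prism_linear sum.distrib sum_distrib_left)

lemma twist_linear:
  "twist p k (\<lambda>ys. a * f ys + b * g ys) = (\<lambda>xs. a * twist p k f xs + b * twist p k g xs)"
  unfolding twist_def cyc_diff_def cyc_sum_def
  by (auto simp: sum.distrib sum_distrib_left algebra_simps)

lemma twist_cong:
  assumes "\<And>i. f (map (shift p ^^ i) xs) = g (map (shift p ^^ i) xs)"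
  shows "twist p k f xs = twist p k g xs"
  using assms[of 0] assms[of 1] assms unfolding twist_def cyc_diff_def cyc_sum_def by simp

lemma eval_chain_linear:
  "eval_chain p n k (\<lambda>ys. a * f ys + b * g ys) = a * eval_chain p n k f + b * eval_chain p n k g"
  by (induction k arbitrary: f g) (simp_all add: contraction_linear twist_linear)

lemma eval_chain_scale: "eval_chain p n k (\<lambda>ys. a * f ys) = a * eval_chain p n k f"
  using eval_chain_linear[of p n k a f 0 f] by simp

lemma eval_chain_zero [simp]: "eval_chain p n k (\<lambda>_. 0) = 0"
  using eval_chain_scale[of p n k 0] by simp

lemma eval_chain_diff: "eval_chain p n k (\<lambda>ys. f ys - g ys) = eval_chain p n k f - eval_chain p n k g"
  using eval_chain_linear[of p n k 1 f "-1" g] by simp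

lemma eval_chain_sum:
  "finite I \<Longrightarrow> eval_chain p n k (\<lambda>ys. \<Sum>i\<in>I. f i ys) = (\<Sum>i\<in>I. eval_chain p n k (f i))"
proof (induction I rule: finite_induct)
  case (insert i I)
  then show ?case
    using eval_chain_linear[of p n k 1 "f i" 1 "\<lambda>ys. \<Sum>i\<in>I. f i ys"] by simp
qed simp

lemma near_constant:
  assumes p: "0 < p"
  shows "near p n 0 (set [replicate n 0])"
proof -
  have "set (replicate n 0) \<subseteq> {..<p}"
    using p by (cases "n = 0") auto
  then show ?thesis
    unfolding near_def words_def by (auto intro!: exI[of _ "{}"])
qed

text \<open>The chain of index \<open>k\<close> involves only lists of \<open>Suc k\<close> words
  that form a near set. Hence identities that hold just for words with few changes can be
  evaluated.\<close>

lemma eval_chain_cong: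
  assumes p: "0 < p"
    and "\<And>xs. length xs = Suc k \<Longrightarrow> near p n k (set xs) \<Longrightarrow> f xs = g xs"
  shows "eval_chain p n k f = eval_chain p n k g"
  using assms(2)
proof (induction k arbitrary: f g)
  case 0
  have "near p n 0 (set [replicate n 0])"
    by (rule near_constant[OF p])
  then show ?case
    using 0 by simp
next
  case (Suc k)
  have contr: "contraction n f xs = contraction n g xs" if "length xs = Suc k" "near p n k (set xs)" for xs
    unfolding contraction_def
  proof (intro sum.cong refl prism_cong)
    fix t ys
    assume "t \<in> {..<n}" and sub: "set ys \<subseteq> reset t ` set xs \<union> reset (Suc t) ` set xs"
      and "length ys = Suc (length xs)"
    then show "f ys = g ys"
      using that p near_subset[OF near_reset sub] by (intro Suc.prems) auto
  qed
  have "twist p k (contraction n f) xs = twist p k (contraction n g) xs"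
    if xs: "length xs = Suc k" "near p n k (set xs)" for xs
  proof (intro twist_cong contr)
    show "near p n k (set (map (shift p ^^ i) xs))" for i
      using near_shift_funpow[OF p xs(2), of i] by simp
  qed (simp add: xs(1))
  then show ?case
    unfolding eval_chain.simps by (rule Suc.IH)
qed

text \<open>The prism homotopies for \<open>t < n\<close> telescope, leaving the pullbacks along the
  constant map \<open>reset n\<close> and the identity \<open>reset 0\<close>.\<close>

lemma contraction_homotopy:
  assumes "set xs \<subseteq> words p n"
  shows "contraction n (cobd f) xs
    = f (replicate (length xs) (replicate n 0)) - f xs - cobd (contraction n f) xs"
proof -
  have "cobd (contraction n f) xs = (\<Sum>t<n. cobd (prism (reset t) (reset (Suc t)) f) xs)"
    using cobd_sum[of "{..<n}" "\<lambda>t. prism (reset t) (reset (Suc t)) f" xs]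
    by (simp add: contraction_def[abs_def])
  then have "cobd (contraction n f) xs + contraction n (cobd f) xs
      = (\<Sum>t<n. f (map (reset (Suc t)) xs) - f (map (reset t) xs))"
    unfolding contraction_def by (simp add: prism_homotopy flip: sum.distrib)
  also have "\<dots> = f (map (reset n) xs) - f (map (reset 0) xs)"
    by (rule sum_lessThan_telescope)
  also have "map (reset n) xs = replicate (length xs) (replicate n 0)"
    using assms by (auto simp: reset_def words_def subset_iff map_replicate_const[symmetric])
  also have "map (reset 0) xs = xs"
    by (simp add: reset_def map_idI)
  finally show ?thesis
    by simp
qed

text \<open>In either order, \<open>1 - s\<close> times the sum of all powers of \<open>s\<close> is
  \<open>1 - s^p\<close>, which is zero on words.\<close>

lemma twist_twist:
  assumes xs: "set xs \<subseteq> words p n"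
  shows "twist p k (twist p (Suc k) f) xs = 0"
proof -
  have period: "map (shift p ^^ p) xs = xs"
    using xs shift_funpow_period by (intro map_idI) auto
  have comm: "map (shift p ^^ i) (map (shift p) xs) = map (shift p ^^ Suc i) xs" for i
    by (simp add: funpow_Suc_right del: funpow.simps)
  have comm': "map (shift p) (map (shift p ^^ i) xs) = map (shift p ^^ Suc i) xs" for i
    by simp
  let ?a = "\<lambda>i. f (map (shift p ^^ i) xs)"
  have "(\<Sum>i<p. ?a (Suc i)) = (\<Sum>i<p. ?a i) + ?a p - ?a 0"
    using sum.lessThan_Suc_shift[of ?a p] sum.lessThan_Suc[of ?a p] by simp
  then have "(\<Sum>i<p. ?a (Suc i)) = (\<Sum>i<p. ?a i)"
    using period by simp
  then show ?thesis
    unfolding twist_def cyc_diff_def cyc_sum_def by (auto simp only: comm comm' sum_subtractf even_Suc split: if_split)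
qed

lemma cobd_twist: "cobd (twist p k f) xs = twist p k (cobd f) xs"
  unfolding twist_def by (simp add: cobd_cyc_sum cobd_cyc_diff)

text \<open>On chains this computes the boundary modulo \<open>p\<close>. The homotopy formula
  leaves the term of the constant word, which the twist kills modulo \<open>p\<close>, the twisted
  cochain itself, and a coboundary. The latter is handled by the previous index and
  \<open>twist_twist\<close>.\<close>

lemma eval_chain_stokes:
  assumes p: "0 < p"
  shows "int p dvd eval_chain p n (Suc k) (cobd f) + eval_chain p n k (twist p k f)"
proof -
  have step: "int p dvd eval_chain p n (Suc k) (cobd f) + eval_chain p n k (twist p k f)"
    if boundary: "int p dvd eval_chain p n k (cobd (twist p k (contraction n f)))" for k f
  proof -
    \<comment> \<open>A difference kills the constant, while a sum over the group multiplies it by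
      \<open>p\<close>; hence the two cases.\<close>
    define c where "c = (if even k then 0 else f (replicate (Suc k) (replicate n 0)))"
    have "twist p k (contraction n (cobd f)) xs
        = (int p * c - twist p k f xs) - cobd (twist p k (contraction n f)) xs"
      if len: "length xs = Suc k" and xs: "near p n k (set xs)" for xs
    proof -
      have "twist p k (contraction n (cobd f)) xs = twist p k (\<lambda>xs.
          f (replicate (length xs) (replicate n 0)) - f xs - cobd (contraction n f) xs) xs"
      proof (rule twist_cong, rule contraction_homotopy)
        show "set (map (shift p ^^ i) xs) \<subseteq> words p n" for i
          using near_shift_funpow[OF p xs] unfolding near_def by simp
      qed
      also have "\<dots> = (int p * c - twist p k f xs) - twist p k (cobd (contraction n f)) xs"
        using len by (simp add: twist_def cyc_diff_def cyc_sum_def sum_subtractf c_def)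
      finally show ?thesis
        by (simp add: cobd_twist)
    qed
    then have "eval_chain p n (Suc k) (cobd f)
        = eval_chain p n k (\<lambda>xs. (int p * c - twist p k f xs) - cobd (twist p k (contraction n f)) xs)"
      unfolding eval_chain.simps by (rule eval_chain_cong[OF p])
    also have "\<dots> = int p * eval_chain p n k (\<lambda>_. c) - eval_chain p n k (twist p k f)
        - eval_chain p n k (cobd (twist p k (contraction n f)))"
      by (simp only: eval_chain_diff eval_chain_scale)
    finally show ?thesis
      using boundary by (simp del: eval_chain.simps)
  qed
  show ?thesis
  proof (induction k arbitrary: f)
    case 0
    show ?case
      by (rule step) (simp add: twist_def cyc_diff_def)
  next
    case (Suc k)
    define h where "h = twist p (Suc k) (contraction n f)"
    have "eval_chain p n k (twist p k h) = eval_chain p n k (\<lambda>_. 0)"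
      by (rule eval_chain_cong[OF p]) (auto simp: h_def near_def intro: twist_twist)
    then have "int p dvd eval_chain p n (Suc k) (cobd h)"
      using Suc[of h] by simp
    then show ?case
      unfolding h_def by (rule step)
  qed
qed

section \<open>Pairing the chains with an equivariant labelling\<close>

lemma near_changes: "near p n k X \<Longrightarrow> w \<in> X \<Longrightarrow> w \<in> words p n \<and> changes w \<le> k"
  unfolding near_def by blast

text \<open>A Tucker-type lemma for the cyclic group of order \<open>p\<close>: the assumption
  \<open>proper\<close> takes the place of forbidding complementary labels on one simplex.\<close>

lemma equivariant_labelling_impossible:
  fixes lam :: "nat list \<Rightarrow> nat \<times> nat"
  assumes p: "prime p" and N: "N = (p - 1) * m"
    and equiv: "\<And>w. w \<in> words p n \<Longrightarrow> changes w \<le> N \<Longrightarrow> lam (shift p w) = rot p (lam w)"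
    and range: "\<And>w. w \<in> words p n \<Longrightarrow> changes w \<le> N \<Longrightarrow> snd (lam w) \<in> {1..m}"
    and proper: "\<And>X. near p n N X \<Longrightarrow> proper_fibers p (lam ` X)"
  shows False
proof -
  have p0: "0 < p"
    using p by (rule prime_gt_0_nat)
  have p_pos: "0 < int p"
    using p0 by simp
  \<comment> \<open>The label cochain of index \<open>Suc k\<close> is supported on lists of
    \<open>Suc k\<close> labels, which matches the lists in the chain of index
    \<open>k\<close>.\<close>
  define L where "L = (\<lambda>k xs. label_cochain p (Suc k) (map lam xs))"
  have lam_shift: "map lam (map (shift p ^^ i) xs) = map (rot p ^^ i) (map lam xs)"
    if xs: "near p n N (set xs)" for xs i
  proof (induction i)
    case (Suc i)
    have "near p n N ((shift p ^^ i) ` set xs)"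
      using p0 xs by (rule near_shift_funpow)
    then have "lam (shift p ((shift p ^^ i) w)) = rot p (lam ((shift p ^^ i) w))" if "w \<in> set xs" for w
      using that by (intro equiv) (auto dest: near_changes)
    then show ?case
      using Suc by simp
  qed simp
  have lam_shift1: "map lam (map (shift p) xs) = map (rot p) (map lam xs)"
    if xs: "near p n N (set xs)" for xs
    using lam_shift[OF xs, of 1] by simp
  have cobd_L: "cobd (L k) xs = twist p k (L (Suc k)) xs"
    if "near p n N (set xs)" for k xs
  proof -
    have pf: "proper_fibers p (set (map lam xs))"
      using proper[OF that] by simp
    have "cobd (L k) xs = cobd (label_cochain p (Suc k)) (map lam xs)"
      unfolding L_def by (simp add: cobd_map del: label_cochain.simps)
    also have "\<dots> = (if even k then cyc_diff (rot p) (label_cochain p (Suc (Suc k))) (map lam xs)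
        else cyc_sum p (rot p) (label_cochain p (Suc (Suc k))) (map lam xs))"
      using label_cochain_step(3,4)[OF p pf, of "Suc k"] by (simp del: label_cochain.simps)
    also have "\<dots> = twist p k (L (Suc k)) xs"
      unfolding twist_def L_def cyc_diff_def cyc_sum_def
      by (cases "even k") (simp_all only: lam_shift[OF that] lam_shift1[OF that] if_True if_False simp_thms)
    finally show ?thesis .
  qed
  \<comment> \<open>The invariant: the \<open>k\<close>-th chain paired with the norm of the
    \<open>k\<close>-th label cochain. Modulo \<open>p\<close>, only its sign changes with
    \<open>k\<close>.\<close>
  define V where "V = (\<lambda>k. eval_chain p n k (cyc_sum p (shift p) (L k)))"
  have step: "int p dvd V (Suc k) + V k" if k: "Suc k \<le> N" for k
  proof (cases "even k")
    case False
    have "eval_chain p n (Suc k) (cobd (L k)) = eval_chain p n (Suc k) (twist p k (L (Suc k)))"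
      by (rule eval_chain_cong[OF p0], rule cobd_L, rule near_mono) (use k in auto)
    then show ?thesis
      using eval_chain_stokes[OF p0, of n k "L k"] False
      unfolding V_def by (simp add: twist_def del: eval_chain.simps)
  next
    case True
    \<comment> \<open>For even \<open>k\<close> the coboundary equation speaks of differences only,
      so the powers of the shift are treated one by one. Then \<open>B i + A i\<close> is
      independent of \<open>i\<close> modulo \<open>p\<close>, and a sum of \<open>p\<close>
      congruent numbers is divisible by \<open>p\<close>.\<close>
    define A where "A = (\<lambda>i. eval_chain p n k (\<lambda>xs. L k (map (shift p ^^ i) xs)))"
    define B where "B = (\<lambda>i. eval_chain p n (Suc k) (\<lambda>xs. L (Suc k) (map (shift p ^^ i) xs)))"
    have comm: "map (shift p ^^ i) (map (shift p) xs) = map (shift p ^^ Suc i) xs" for i xs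
      by (simp add: funpow_Suc_right del: funpow.simps)
    have diff: "int p dvd (B i + A i) - (B (Suc i) + A (Suc i))" for i
    proof -
      let ?f = "\<lambda>xs. L k (map (shift p ^^ i) xs)"
      have "eval_chain p n (Suc k) (cobd ?f) = eval_chain p n (Suc k)
          (\<lambda>xs. L (Suc k) (map (shift p ^^ i) xs) - L (Suc k) (map (shift p ^^ Suc i) xs))"
      proof (rule eval_chain_cong[OF p0])
        fix xs assume "near p n (Suc k) (set xs)"
        then have "near p n N (set (map (shift p ^^ i) xs))"
          using near_shift_funpow[OF p0] near_mono k by (metis list.set_map)
        then have "cobd (L k) (map (shift p ^^ i) xs) = twist p k (L (Suc k)) (map (shift p ^^ i) xs)"
          by (rule cobd_L)
        then show "cobd ?f xs = L (Suc k) (map (shift p ^^ i) xs) - L (Suc k) (map (shift p ^^ Suc i) xs)"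
          using True by (simp add: cobd_map twist_def cyc_diff_def)
      qed
      then have "eval_chain p n (Suc k) (cobd ?f) = B i - B (Suc i)"
        unfolding B_def by (simp only: eval_chain_diff)
      moreover have "twist p k ?f = (\<lambda>xs. L k (map (shift p ^^ i) xs) - L k (map (shift p ^^ Suc i) xs))"
        using True by (simp only: twist_def if_True cyc_diff_def[abs_def] comm)
      then have "eval_chain p n k (twist p k ?f) = A i - A (Suc i)"
        unfolding A_def by (simp only: eval_chain_diff)
      ultimately have "eval_chain p n (Suc k) (cobd ?f) + eval_chain p n k (twist p k ?f)
          = (B i + A i) - (B (Suc i) + A (Suc i))"
        by linarith
      then show ?thesis
        using eval_chain_stokes[OF p0, of n k ?f] by (simp only:)
    qed
    have const: "int p dvd (B 0 + A 0) - (B i + A i)" for i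
    proof (induction i)
      case (Suc i)
      have "(B 0 + A 0) - (B (Suc i) + A (Suc i))
          = ((B 0 + A 0) - (B i + A i)) + ((B i + A i) - (B (Suc i) + A (Suc i)))"
        by simp
      then show ?case
        using dvd_add[OF Suc diff[of i]] by (simp only:)
    qed simp
    have "int p dvd (\<Sum>i<p. (B 0 + A 0) - (B i + A i))"
      by (intro dvd_sum const)
    then have "int p dvd int p * (B 0 + A 0) - ((\<Sum>i<p. B i) + (\<Sum>i<p. A i))"
      by (simp add: sum_subtractf sum.distrib)
    then have "int p dvd (\<Sum>i<p. B i) + (\<Sum>i<p. A i)"
      by (simp add: dvd_diff_right_iff)
    moreover have "V (Suc k) = (\<Sum>i<p. B i)"
      unfolding V_def B_def cyc_sum_def[abs_def]
      by (rule eval_chain_sum) simp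
    moreover have "V k = (\<Sum>i<p. A i)"
      unfolding V_def A_def cyc_sum_def[abs_def]
      by (rule eval_chain_sum) simp
    ultimately show ?thesis by simp
  qed
  have "\<not> int p dvd V k" if "k \<le> N" for k
    using that
  proof (induction k)
    case 0
    have "near p n 0 (set [replicate n 0])"
      by (rule near_constant[OF p0])
    then have near: "near p n N (set [replicate n 0])"
      by (rule near_mono) simp
    have "V 0 = cyc_sum p (rot p) (label_cochain p (Suc 0)) (map lam [replicate n 0])"
      unfolding V_def eval_chain.simps cyc_sum_def L_def lam_shift[OF near] ..
    also have "\<dots> = cobd (label_cochain p 0) (map lam [replicate n 0])"
      by (rule label_cochain_step(3)[OF p]) (use proper[OF near] in auto)
    also have "\<dots> = 1"
      by simp
    finally show ?case
      using prime_gt_1_nat[OF p] by (simp add: zdvd1_eq)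
  next
    case (Suc k)
    then show ?case
      using step[of k] dvd_add_right_iff[of "int p" "V (Suc k)" "V k"] by auto
  qed
  then have "\<not> int p dvd V N"
    by simp
  moreover have "V N = eval_chain p n N (\<lambda>_. 0)"
    unfolding V_def
  proof (rule eval_chain_cong[OF p0])
    fix xs assume len: "length xs = Suc N" and near: "near p n N (set xs)"
    have "L N (map (shift p ^^ i) xs) = 0" for i
    proof -
      define ls where "ls = map lam (map (shift p ^^ i) xs)"
      have near': "near p n N (set (map (shift p ^^ i) xs))"
        using near_shift_funpow[OF p0 near] by simp
      have pf: "proper_fibers p (set ls)"
        using proper[OF near'] unfolding ls_def by (simp only: set_map)
      \<comment> \<open>Each of the \<open>m\<close> colors contributes at most \<open>p - 1\<close>
        labels, so a list of \<open>N + 1\<close> labels must repeat one.\<close>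
      have sub: "set ls \<subseteq> (\<Union>j\<in>{1..m}. {s. (s, j) \<in> set ls} \<times> {j})"
      proof
        fix l assume l: "l \<in> set ls"
        then obtain w where "w \<in> set (map (shift p ^^ i) xs)" "l = lam w"
          unfolding ls_def by auto
        then have "snd l \<in> {1..m}"
          using range near_changes[OF near'] by blast
        then show "l \<in> (\<Union>j\<in>{1..m}. {s. (s, j) \<in> set ls} \<times> {j})"
          using l by (cases l) auto
      qed
      have fiber: "finite {s. (s, j) \<in> set ls} \<and> card {s. (s, j) \<in> set ls} \<le> p - 1" for j
      proof -
        have sub: "{s. (s, j) \<in> set ls} \<subset> {..<p}"
          using pf unfolding proper_fibers_def by blast
        have "finite {s. (s, j) \<in> set ls}"
          by (rule finite_subset[OF psubset_imp_subset[OF sub]]) simp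
        moreover have "card {s. (s, j) \<in> set ls} < card {..<p}"
          by (rule psubset_card_mono[OF _ sub]) simp
        ultimately show ?thesis
          by simp
      qed
      have "card (set ls) \<le> card (\<Union>j\<in>{1..m}. {s. (s, j) \<in> set ls} \<times> {j})"
        by (rule card_mono[OF _ sub]) (use fiber in auto)
      also have "\<dots> \<le> (\<Sum>j\<in>{1..m}. card ({s. (s, j) \<in> set ls} \<times> {j}))"
        by (rule card_UN_le) simp
      also have "\<dots> \<le> (\<Sum>j\<in>{1..m}. p - 1)"
        by (rule sum_mono) (use fiber in \<open>simp add: card_cartesian_product\<close>)
      also have "\<dots> = N"
        using N by simp
      finally have "\<not> distinct ls"
        using len distinct_card[of ls] unfolding ls_def by auto
      then show ?thesis
        unfolding L_def ls_def by (rule alternating_not_distinct[OF alternating_label_cochain])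
    qed
    then show "cyc_sum p (shift p) (L N) xs = 0"
      unfolding cyc_sum_def by simp
  qed
  ultimately show False
    by simp
qed

section \<open>Approximate splittings for a prime number of thieves\<close>

lemma count_list_card: "count_list xs y = card {i. i < length xs \<and> xs ! i = y}"
  by (simp add: count_list_eq_length_filter length_filter_conv_card eq_commute)

lemma count_zip_card:
  assumes "length w = length xs"
  shows "count_list (zip xs w) (j, s) = card {i. i < length xs \<and> xs ! i = j \<and> w ! i = s}"
  unfolding count_list_card using assms by (intro arg_cong[of _ _ card] Collect_cong) auto

lemma sum_count_zip:
  fixes w :: "nat list"
  assumes "length xs = length w" "set w \<subseteq> {..<p}"
  shows "(\<Sum>s<p. count_list (zip xs w) (j, s)) = count_list xs j"
  using assms
proof (induction xs w rule: list_induct2)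
  case (Cons x xs s w)
  have "(\<Sum>t<p. count_list (zip (x # xs) (s # w)) (j, t))
      = (\<Sum>t<p. count_list (zip xs w) (j, t) + (if t = s then if x = j then 1 else 0 else 0))"
    by (rule sum.cong) auto
  also have "\<dots> = count_list xs j + (\<Sum>t<p. if t = s then if x = j then 1 else 0 else 0)"
    using Cons by (simp only: sum.distrib) simp
  also have "(\<Sum>t<p. if t = s then if x = j then 1 else 0 else 0) = (if x = j then 1 else 0::nat)"
    using Cons.prems by (subst sum.delta) auto
  also have "count_list xs j + \<dots> = count_list (x # xs) j"
    by simp
  finally show ?case .
qed simp

lemma count_zip_map:
  assumes "length xs = length w" "inj_on g (insert s (set w))"
  shows "count_list (zip xs (map g w)) (j, g s) = count_list (zip xs w) (j, s)"
  using assms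
proof (induction xs w rule: list_induct2)
  case (Cons x xs t w)
  then have "inj_on g (insert s (set w))"
    by (auto intro: inj_on_subset)
  moreover have "g t = g s \<longleftrightarrow> t = s"
    using Cons.prems by (auto simp: inj_on_def)
  ultimately show ?case
    using Cons.IH by auto
qed simp

text \<open>With the error \<open>p * N\<close>, a thief over the bound in one word of a near set is
  still above average in every other word of it, as these differ in at most \<open>N\<close> beads.
  All thieves cannot be above average in one word, so the labels have proper fibers.\<close>

lemma prime_approximate_splitting:
  assumes p: "prime p" and xs: "set xs \<subseteq> {1..m}"
  defines "N \<equiv> (p - 1) * m"
  shows "\<exists>w\<in>words p (length xs). changes w \<le> N \<and>
    (\<forall>j\<in>{1..m}. \<forall>s<p. p * count_list (zip xs w) (j, s) \<le> count_list xs j + p * N)"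
proof (rule ccontr)
  assume neg: "\<not> ?thesis"
  have p0: "0 < p"
    using p by (rule prime_gt_0_nat)
  define n where "n = length xs"
  define over where "over = (\<lambda>w l. fst l < p \<and> snd l \<in> {1..m} \<and>
      count_list xs (snd l) + p * N < p * count_list (zip xs w) (snd l, fst l))"
  have ex_over: "\<exists>l. over w l" if w: "w \<in> words p n" "changes w \<le> N" for w
  proof -
    obtain j s where "j \<in> {1..m}" "s < p"
      "\<not> p * count_list (zip xs w) (j, s) \<le> count_list xs j + p * N"
      using neg w unfolding n_def by blast
    then have "over w (s, j)"
      unfolding over_def by simp
    then show ?thesis ..
  qed
  \<comment> \<open>The orbit representative is found from \<open>hd w\<close>, which needs a bead.
    On the empty necklace no thief is over the bound.\<close>
  have n_pos: "0 < n"
  proof (rule ccontr)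
    assume "\<not> 0 < n"
    then have "[] \<in> words p n" "changes ([]::nat list) \<le> N" "xs = []"
      by (auto simp: words_def changes_def n_def)
    then show False
      using ex_over[of "[]"] by (auto simp: over_def)
  qed
  have over_shift: "over (shift p w) (rot p l)" if "w \<in> words p n" "over w l" for w l
  proof -
    have "insert (fst l) (set w) \<subseteq> {..<p}"
      using that unfolding over_def words_def by simp
    then have "inj_on (\<lambda>x. Suc x mod p) (insert (fst l) (set w))"
      by (intro inj_onI) (rule Suc_mod_inj, auto)
    then have "count_list (zip xs (shift p w)) (snd l, Suc (fst l) mod p) = count_list (zip xs w) (snd l, fst l)"
      unfolding shift_def using that(1) by (intro count_zip_map) (auto simp: words_def n_def)
    then show ?thesis
      using that(2) p0 unfolding over_def rot_def by simp
  qed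
  have words_funpow: "(shift p ^^ i) w \<in> words p n \<and> changes ((shift p ^^ i) w) = changes w"
    if "w \<in> words p n" for w i
    using that by (induction i) (auto simp: shift_words[OF p0] changes_shift)
  have over_funpow: "over ((shift p ^^ i) w) ((rot p ^^ i) l)" if "w \<in> words p n" "over w l" for w l i
    using that by (induction i) (auto intro: over_shift simp: words_funpow)
  text \<open>The label is chosen for the word of the orbit that starts with 0 and carried along the orbit.\<close>
  define lam where "lam = (\<lambda>w. (rot p ^^ hd w) (SOME l. over ((shift p ^^ (p - hd w)) w) l))"
  have over_some: "over ((shift p ^^ i) w) (SOME l. over ((shift p ^^ i) w) l)"
    if "w \<in> words p n" "changes w \<le> N" for w i
    by (rule someI_ex, rule ex_over) (use that words_funpow in auto)
  have hd_less: "hd w < p" if "w \<in> words p n" for w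
    using that n_pos unfolding words_def by (cases w) auto
  have over_lam: "over w (lam w)" if w: "w \<in> words p n" "changes w \<le> N" for w
  proof -
    have "over ((shift p ^^ hd w) ((shift p ^^ (p - hd w)) w)) (lam w)"
      unfolding lam_def by (rule over_funpow) (use words_funpow over_some w in auto)
    also have "(shift p ^^ hd w) ((shift p ^^ (p - hd w)) w) = (shift p ^^ (hd w + (p - hd w))) w"
      by (simp only: funpow_add o_apply)
    also have "\<dots> = w"
      using hd_less[OF w(1)] shift_funpow_period[OF w(1)] by simp
    finally show ?thesis .
  qed
  show False
  proof (rule equivariant_labelling_impossible[OF p, of N m n lam])
    show "N = (p - 1) * m"
      by (rule N_def[THEN meta_eq_to_obj_eq])
  next
    fix w assume w: "w \<in> words p n" "changes w \<le> N"
    show "snd (lam w) \<in> {1..m}"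
      using over_lam[OF w] unfolding over_def by blast
    have hd: "hd (shift p w) = Suc (hd w) mod p"
      using w(1) n_pos unfolding words_def shift_def by (cases w) auto
    show "lam (shift p w) = rot p (lam w)"
    \<comment> \<open>Here the orbit closes: the label chosen for the representative must come back
      after \<open>p\<close> rotations.\<close>
    proof (cases "Suc (hd w) = p")
      case True
      then have "p - hd w = 1"
        by simp
      define l where "l = (SOME l. over (shift p w) l)"
      have "over (shift p w) l"
        unfolding l_def using over_some[OF w, of 1] by simp
      then have "fst l < p"
        unfolding over_def by blast
      have "rot p (lam w) = (rot p ^^ Suc (hd w)) l"
        unfolding lam_def l_def \<open>p - hd w = 1\<close> by simp
      also have "\<dots> = l"
        unfolding True using \<open>fst l < p\<close> by (simp add: rot_funpow)
      also have "l = lam (shift p w)"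
        unfolding lam_def hd l_def True using shift_funpow_period[OF shift_words[OF p0 w(1)]] by simp
      finally show ?thesis ..
    next
      case False
      then have h: "Suc (hd w) < p"
        using hd_less[OF w(1)] by simp
      have "(shift p ^^ (p - Suc (hd w))) (shift p w) = (shift p ^^ Suc (p - Suc (hd w))) w"
        by (simp add: funpow_Suc_right del: funpow.simps)
      also have "Suc (p - Suc (hd w)) = p - hd w"
        using h by simp
      finally show ?thesis
        unfolding lam_def hd using h by simp
    qed
  next
    fix X assume X: "near p n N X"
    show "proper_fibers p (lam ` X)"
      unfolding proper_fibers_def
    proof (intro conjI allI)
      have over_X: "over w (lam w)" if "w \<in> X" for w
        using over_lam near_changes[OF X that] by blast
      then show "lam ` X \<subseteq> {..<p} \<times> UNIV"
        unfolding over_def by (simp add: image_subset_iff mem_Times_iff)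
      fix j
      show "\<exists>s<p. (s, j) \<notin> lam ` X"
      proof (rule ccontr)
        assume "\<not> ?thesis"
        then have all: "\<exists>w\<in>X. lam w = (s, j)" if "s < p" for s
          using that by force
        obtain v where v: "v \<in> X"
          using all[OF p0] by blast
        obtain D where D: "finite D" "card D \<le> N"
          "\<forall>v\<in>X. \<forall>w\<in>X. \<forall>i<n. i \<notin> D \<longrightarrow> v ! i = w ! i"
          using X unfolding near_def by blast
        have v_len: "length v = length xs" "set v \<subseteq> {..<p}"
          using near_changes[OF X v] unfolding words_def n_def by auto
        have "Suc (count_list xs j) \<le> p * count_list (zip xs v) (j, s)" if s: "s < p" for s
        proof -
          obtain w where w: "w \<in> X" "lam w = (s, j)"
            using all[OF s] by blast
          have w_len: "length w = length xs"
            using near_changes[OF X w(1)] unfolding words_def n_def by auto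
          have "{i. i < length xs \<and> xs ! i = j \<and> w ! i = s}
              \<subseteq> {i. i < length xs \<and> xs ! i = j \<and> v ! i = s} \<union> D"
          proof
            fix i assume i: "i \<in> {i. i < length xs \<and> xs ! i = j \<and> w ! i = s}"
            then have "i \<notin> D \<longrightarrow> v ! i = w ! i"
              using D(3) v w(1) unfolding n_def by blast
            then show "i \<in> {i. i < length xs \<and> xs ! i = j \<and> v ! i = s} \<union> D"
              using i by auto
          qed
          then have "card {i. i < length xs \<and> xs ! i = j \<and> w ! i = s}
              \<le> card ({i. i < length xs \<and> xs ! i = j \<and> v ! i = s} \<union> D)"
            using D(1) by (intro card_mono) auto
          also have "\<dots> \<le> card {i. i < length xs \<and> xs ! i = j \<and> v ! i = s} + card D"
            by (rule card_Un_le)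
          finally have "count_list (zip xs w) (j, s) \<le> count_list (zip xs v) (j, s) + N"
            using D(2) by (simp add: count_zip_card w_len v_len(1))
          then have "p * count_list (zip xs w) (j, s) \<le> p * count_list (zip xs v) (j, s) + p * N"
            by (metis add_mult_distrib2 mult_le_mono2)
          moreover have "count_list xs j + p * N < p * count_list (zip xs w) (j, s)"
            using over_X[OF w(1)] unfolding w(2) over_def by simp
          ultimately show ?thesis
            by linarith
        qed
        then have "(\<Sum>s<p. Suc (count_list xs j)) \<le> (\<Sum>s<p. p * count_list (zip xs v) (j, s))"
          by (intro sum_mono) simp
        also have "\<dots> = p * count_list xs j"
          using sum_count_zip[OF v_len(1)[symmetric] v_len(2)] by (simp flip: sum_distrib_left)
        finally show False
          using p0 by simp
      qed
    qed
  qed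
qed

section \<open>Approximate splittings for composite numbers of thieves\<close>

text \<open>The error \<open>c\<close> is fixed before the necklace. This uniformity is what lets it
  disappear when every bead is refined.\<close>

definition splittable :: "nat \<Rightarrow> nat \<Rightarrow> bool" where
  "splittable m q \<longleftrightarrow> (\<exists>c. \<forall>xs. set xs \<subseteq> {1..m} \<longrightarrow>
     (\<exists>w\<in>words q (length xs). changes w \<le> (q - 1) * m \<and>
       (\<forall>j\<in>{1..m}. \<forall>s<q. q * count_list (zip xs w) (j, s) \<le> count_list xs j + c)))"

lemma splittable_prime: "prime p \<Longrightarrow> splittable m p"
  unfolding splittable_def using prime_approximate_splitting by blast

lemma splittable_1: "splittable m 1"
  unfolding splittable_def
proof (intro exI[of _ 0] allI impI)
  fix xs :: "nat list"
  have "replicate (length xs) 0 \<in> words 1 (length xs)"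
    by (auto simp: words_def)
  moreover have "count_list (zip xs (replicate (length xs) (0::nat))) (j, 0) = count_list xs j" for j
    by (induction xs) auto
  ultimately show "\<exists>w\<in>words 1 (length xs). changes w \<le> (1 - 1) * m \<and>
       (\<forall>j\<in>{1..m}. \<forall>s<1. 1 * count_list (zip xs w) (j, s) \<le> count_list xs j + 0)"
    by (intro bexI[of _ "replicate (length xs) 0"]) auto
qed

text \<open>A two-level assignment written as one word: \<open>ws\<close> names the part of each
  bead, \<open>u s\<close> is a queue with the assignment inside part \<open>s\<close>, and the pair
  \<open>(s, t)\<close> is coded as \<open>s * b + t\<close>.\<close>

fun merge :: "nat \<Rightarrow> nat list \<Rightarrow> (nat \<Rightarrow> nat list) \<Rightarrow> nat list" where
  "merge b [] u = []"
| "merge b (s # ws) u = (s * b + hd (u s)) # merge b ws (u(s := tl (u s)))"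

fun part :: "nat list \<Rightarrow> nat list \<Rightarrow> nat \<Rightarrow> nat list" where
  "part (x # xs) (w # ws) s = (if w = s then x # part xs ws s else part xs ws s)"
| "part _ _ s = []"

lemma length_part: "length xs = length ws \<Longrightarrow> length (part xs ws s) = count_list ws s"
  by (induction xs ws rule: list_induct2) auto

lemma count_part: "length xs = length ws \<Longrightarrow> count_list (part xs ws s) j = count_list (zip xs ws) (j, s)"
  by (induction xs ws rule: list_induct2) auto

lemma set_part: "set (part xs ws s) \<subseteq> set xs"
  by (induction xs ws s rule: part.induct) auto

lemma merge_words:
  assumes "set ws \<subseteq> {..<a}" "\<And>s. length (u s) = count_list ws s" "\<And>s. set (u s) \<subseteq> {..<b}"
  shows "merge b ws u \<in> words (a * b) (length ws)"
  using assms
proof (induction ws arbitrary: u)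
  case (Cons s ws)
  have ne: "u s \<noteq> []"
    using Cons.prems(2)[of s] by auto
  have "hd (u s) < b"
    using subsetD[OF Cons.prems(3) hd_in_set[OF ne]] by simp
  moreover have "Suc s \<le> a"
    using Cons.prems(1) by auto
  then have "Suc s * b \<le> a * b"
    by (rule mult_le_mono1)
  ultimately have "s * b + hd (u s) < a * b"
    by simp
  moreover have "merge b ws (u(s := tl (u s))) \<in> words (a * b) (length ws)"
  proof (rule Cons.IH)
    show "length ((u(s := tl (u s))) t) = count_list ws t" for t
      using Cons.prems(2)[of t] by auto
    show "set ((u(s := tl (u s))) t) \<subseteq> {..<b}" for t
      using Cons.prems(3)[of t] list.set_sel(2)[OF ne] by auto
  qed (use Cons.prems(1) in simp)
  ultimately show ?case
    by (simp add: words_def)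
qed (simp add: words_def)

lemma count_merge:
  assumes "length xs = length ws" "\<And>s. length (u s) = count_list ws s" "\<And>s. set (u s) \<subseteq> {..<b}"
    and t: "t < b"
  shows "count_list (zip xs (merge b ws u)) (j, s * b + t) = count_list (zip (part xs ws s) (u s)) (j, t)"
  using assms(1-3)
proof (induction xs ws arbitrary: u rule: list_induct2)
  case (Cons x xs r ws)
  let ?u = "u(r := tl (u r))"
  obtain h us where hu: "u r = h # us"
    using Cons.prems(1)[of r] by (cases "u r") auto
  have h: "h < b"
    using Cons.prems(2)[of r] hu by auto
  have IH: "count_list (zip xs (merge b ws ?u)) (j, s * b + t) = count_list (zip (part xs ws s) (?u s)) (j, t)"
  proof (rule Cons.IH)
    show "length (?u v) = count_list ws v" for v
      using Cons.prems(1)[of v] by auto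
    show "set (?u v) \<subseteq> {..<b}" for v
      using Cons.prems(2)[of v] hu by (cases "v = r") auto
  qed
  have "r * b + h = s * b + t \<longleftrightarrow> r = s \<and> h = t"
  proof
    assume eq: "r * b + h = s * b + t"
    then have "(r * b + h) div b = (s * b + t) div b" "(r * b + h) mod b = (s * b + t) mod b"
      by simp_all
    then show "r = s \<and> h = t"
      using h t by simp
  qed auto
  then show ?case
    using IH hu by auto
qed simp

lemma changes_Nil [simp]: "changes [] = 0"
  and changes_single [simp]: "changes [x] = 0"
  by (simp_all add: changes_def)

lemma changes_Cons_Cons [simp]: "changes (x # y # l) = (if x = y then 0 else 1) + changes (y # l)"
proof -
  let ?A = "\<lambda>w. {i. Suc i < length w \<and> w ! i \<noteq> w ! Suc i}"
  have "?A (x # y # l) = (if x = y then {} else {0}) \<union> Suc ` ?A (y # l)"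
  proof (rule set_eqI)
    show "i \<in> ?A (x # y # l) \<longleftrightarrow> i \<in> (if x = y then {} else {0}) \<union> Suc ` ?A (y # l)" for i
      by (cases i) auto
  qed
  moreover have "finite (?A (y # l))"
    by (rule finite_subset[of _ "{..<length (y # l)}"]) auto
  then have "card ((if x = y then {} else {0}) \<union> Suc ` ?A (y # l)) = (if x = y then 0 else 1) + card (?A (y # l))"
    by (subst card_Un_disjoint) (auto simp: card_image)
  ultimately show ?thesis
    unfolding changes_def by simp
qed

lemma changes_tl: "changes (tl l) \<le> changes l"
  by (cases l; cases "tl l") auto

text \<open>Between beads of the same part, a change is one in the queue of that part. Between
  different parts it is paid for by the change of \<open>ws\<close>, and dropping the head of a
  queue adds none.\<close>

lemma changes_merge:
  assumes "set ws \<subseteq> {..<a}" "\<And>s. length (u s) = count_list ws s"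
  shows "changes (merge b ws u) \<le> changes ws + (\<Sum>s<a. changes (u s))"
  using assms
proof (induction ws arbitrary: u rule: induct_list012)
  case (3 r r' ws)
  let ?u = "u(r := tl (u r))"
  obtain h us where hu: "u r = h # us"
    using "3.prems"(2)[of r] by (cases "u r") auto
  have r: "r < a"
    using "3.prems"(1) by simp
  have "changes (merge b (r' # ws) ?u) \<le> changes (r' # ws) + (\<Sum>s<a. changes (?u s))"
  proof (rule "3.IH"(2))
    show "length (?u v) = count_list (r' # ws) v" for v
      using "3.prems"(2)[of v] by auto
  qed (use "3.prems"(1) in simp)
  moreover have "changes (merge b (r # r' # ws) u)
      = (if r * b + h = r' * b + hd (?u r') then 0 else 1) + changes (merge b (r' # ws) ?u)"
    using hu by simp
  moreover have "(\<Sum>s<a. changes (u s)) = changes (u r) + (\<Sum>s\<in>{..<a} - {r}. changes (u s))"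
    "(\<Sum>s<a. changes (?u s)) = changes us + (\<Sum>s\<in>{..<a} - {r}. changes (u s))"
    using r hu by (simp_all add: sum.remove[of "{..<a}" r])
  moreover have "changes us + (if r * b + h = r' * b + hd (?u r') then 0 else 1)
      \<le> changes (u r) + (if r = r' then 0 else 1)"
  proof (cases "r = r'")
    case True
    obtain h' us' where "us = h' # us'"
      using "3.prems"(2)[of r] hu True by (cases us) auto
    then show ?thesis
      using hu True by simp
  next
    case False
    then show ?thesis
      using changes_tl[of "u r"] hu by simp
  qed
  ultimately show ?case
    by simp
qed auto

text \<open>The necklace is split into \<open>a\<close> parts and each part among \<open>b\<close>
  thieves. The budgets fit because \<open>(a - 1) + a * (b - 1) = a * b - 1\<close>, and the
  combined error \<open>c + a * d\<close> is still independent of the necklace.\<close>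

lemma splittable_mult:
  assumes a: "splittable m a" "1 \<le> a" and b: "splittable m b" "1 \<le> b"
  shows "splittable m (a * b)"
proof -
  obtain c where c: "\<And>xs. set xs \<subseteq> {1..m} \<Longrightarrow> \<exists>w\<in>words a (length xs). changes w \<le> (a - 1) * m \<and>
       (\<forall>j\<in>{1..m}. \<forall>s<a. a * count_list (zip xs w) (j, s) \<le> count_list xs j + c)"
    using a(1) unfolding splittable_def by blast
  obtain d where d: "\<And>xs. set xs \<subseteq> {1..m} \<Longrightarrow> \<exists>w\<in>words b (length xs). changes w \<le> (b - 1) * m \<and>
       (\<forall>j\<in>{1..m}. \<forall>s<b. b * count_list (zip xs w) (j, s) \<le> count_list xs j + d)"
    using b(1) unfolding splittable_def by blast
  have "\<exists>w\<in>words (a * b) (length xs). changes w \<le> (a * b - 1) * m \<and>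
       (\<forall>j\<in>{1..m}. \<forall>s<a * b. a * b * count_list (zip xs w) (j, s) \<le> count_list xs j + (c + a * d))"
    if xs: "set xs \<subseteq> {1..m}" for xs
  proof -
    obtain w where w: "w \<in> words a (length xs)" "changes w \<le> (a - 1) * m"
      "\<forall>j\<in>{1..m}. \<forall>s<a. a * count_list (zip xs w) (j, s) \<le> count_list xs j + c"
      using c[OF xs] by blast
    have len: "length xs = length w" and w_sub: "set w \<subseteq> {..<a}"
      using w(1) unfolding words_def by auto
    have "\<forall>s. \<exists>v. v \<in> words b (length (part xs w s)) \<and> changes v \<le> (b - 1) * m \<and>
       (\<forall>j\<in>{1..m}. \<forall>t<b. b * count_list (zip (part xs w s) v) (j, t) \<le> count_list (part xs w s) j + d)"
      using d set_part xs by (meson subset_trans)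
    then obtain u where u: "\<And>s. u s \<in> words b (length (part xs w s))"
      "\<And>s. changes (u s) \<le> (b - 1) * m"
      "\<And>s j t. j \<in> {1..m} \<Longrightarrow> t < b \<Longrightarrow>
        b * count_list (zip (part xs w s) (u s)) (j, t) \<le> count_list (part xs w s) j + d"
      by metis
    have len_u: "length (u s) = count_list w s" and u_sub: "set (u s) \<subseteq> {..<b}" for s
      using u(1)[of s] length_part[OF len] unfolding words_def by auto
    show ?thesis
    proof (intro bexI[of _ "merge b w u"] conjI ballI allI impI)
      show "merge b w u \<in> words (a * b) (length xs)"
        using merge_words[OF w_sub len_u u_sub] len by simp
      have "changes (merge b w u) \<le> changes w + (\<Sum>s<a. changes (u s))"
        by (rule changes_merge[OF w_sub len_u])
      also have "\<dots> \<le> (a - 1) * m + (\<Sum>s<a. (b - 1) * m)"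
        by (intro add_mono w(2) sum_mono u(2))
      also have "\<dots> = ((a - 1) + a * (b - 1)) * m"
        by (simp add: algebra_simps)
      also have "(a - 1) + a * (b - 1) = a * b - 1"
        using a(2) b(2) by (cases a; cases b) auto
      finally show "changes (merge b w u) \<le> (a * b - 1) * m" .
    next
      fix j r assume j: "j \<in> {1..m}" and r: "r < a * b"
      define s where "s = r div b"
      define t where "t = r mod b"
      have t: "t < b" and s: "s < a" and r_eq: "r = s * b + t"
        using b(2) r unfolding s_def t_def by (auto simp: less_mult_imp_div_less)
      have "b * count_list (zip xs (merge b w u)) (j, r) \<le> count_list (zip xs w) (j, s) + d"
        using u(3)[OF j t, of s] count_merge[OF len len_u u_sub t] count_part[OF len]
        unfolding r_eq by simp
      then have "a * (b * count_list (zip xs (merge b w u)) (j, r)) \<le> a * (count_list (zip xs w) (j, s) + d)"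
        by (rule mult_le_mono2)
      also have "\<dots> \<le> count_list xs j + (c + a * d)"
        using w(3) j s by (simp add: algebra_simps)
      finally show "a * b * count_list (zip xs (merge b w u)) (j, r) \<le> count_list xs j + (c + a * d)"
        by (simp add: algebra_simps)
    qed
  qed
  then show ?thesis
    unfolding splittable_def by blast
qed

lemma splittable:
  assumes "1 \<le> q"
  shows "splittable m q"
  using assms
proof (induction q rule: less_induct)
  case (less q)
  show ?case
  proof (cases "q = 1")
    case True
    then show ?thesis
      using splittable_1 by simp
  next
    case False
    then obtain p where p: "prime p" "p dvd q"
      using prime_factor_nat by blast
    then obtain r where q: "q = p * r"
      by blast
    have "1 \<le> r" "r < q"
      using less.prems q prime_gt_1_nat[OF p(1)] by (cases "r = 0"; simp)+
    then have "splittable m r"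
      using less.IH by blast
    then show ?thesis
      unfolding q using splittable_prime[OF p(1)] \<open>1 \<le> r\<close> prime_ge_1_nat[OF p(1)]
      by (intro splittable_mult)
  qed
qed

section \<open>Hall's theorem and rounding\<close>

text \<open>The argument of Halmos and Vaughan. If no nonempty proper subfamily is tight, one index
  may take any element of its set. Otherwise a tight \<open>J\<close> is represented first, and the
  other indices avoid its union.\<close>

lemma hall_sdr:
  assumes "finite I" and "\<And>i. i \<in> I \<Longrightarrow> finite (S i)"
    and "\<And>J. J \<subseteq> I \<Longrightarrow> card J \<le> card (\<Union>i\<in>J. S i)"
  shows "\<exists>R. inj_on R I \<and> (\<forall>i\<in>I. R i \<in> S i)"
  using assms
proof (induction "card I" arbitrary: I S rule: less_induct)
  case less
  note fin = \<open>finite I\<close> and finS = less.prems(2) and hall = less.prems(3)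
  have finJ: "finite (\<Union>i\<in>J. S i)" if "J \<subseteq> I" for J
    using that fin finS finite_subset[OF that fin] by (auto intro: finite_UN_I)
  consider "I = {}" | (slack) "I \<noteq> {}" "\<And>J. J \<subset> I \<Longrightarrow> J \<noteq> {} \<Longrightarrow> card J < card (\<Union>i\<in>J. S i)"
    | (tight) J where "J \<subset> I" "J \<noteq> {}" "card (\<Union>i\<in>J. S i) \<le> card J"
    by (meson not_less)
  then show ?case
  proof cases
    case slack
    then obtain i0 where i0: "i0 \<in> I"
      by blast
    have "card {i0} \<le> card (\<Union>i\<in>{i0}. S i)"
      by (rule hall) (use i0 in simp)
    then obtain x where x: "x \<in> S i0"
      by (cases "S i0 = {}") auto
    have "\<exists>R. inj_on R (I - {i0}) \<and> (\<forall>i\<in>I - {i0}. R i \<in> S i - {x})"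
    proof (rule less.hyps)
      show "card (I - {i0}) < card I"
        using fin i0 by (rule card_Diff1_less)
      show "card J \<le> card (\<Union>i\<in>J. S i - {x})" if J: "J \<subseteq> I - {i0}" for J
      proof (cases "J = {}")
        case False
        have "card J < card (\<Union>i\<in>J. S i)"
          using J i0 False by (intro slack) auto
        moreover have "(\<Union>i\<in>J. S i - {x}) = (\<Union>i\<in>J. S i) - {x}"
          by blast
        moreover have "card (\<Union>i\<in>J. S i) - 1 \<le> card ((\<Union>i\<in>J. S i) - {x})"
          using finJ[of J] J by (simp add: card_Diff_singleton_if)
        ultimately show ?thesis
          by simp
      qed simp
    qed (use fin finS in auto)
    then obtain R where R: "inj_on R (I - {i0})" "\<forall>i\<in>I - {i0}. R i \<in> S i - {x}"
      by blast
    then have "inj_on (R(i0 := x)) I"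
      by (auto simp: inj_on_def)
    moreover have "\<forall>i\<in>I. (R(i0 := x)) i \<in> S i"
      using R(2) x by auto
    ultimately show ?thesis
      by blast
  next
    case tight
    let ?U = "\<Union>i\<in>J. S i"
    have J: "J \<subseteq> I" and finJ0: "finite J"
      using tight(1) fin finite_subset by auto
    have "\<exists>R. inj_on R J \<and> (\<forall>i\<in>J. R i \<in> S i)"
      by (rule less.hyps) (use J fin finJ0 finS hall psubset_card_mono[OF fin tight(1)] in auto)
    then obtain R where R: "inj_on R J" "\<forall>i\<in>J. R i \<in> S i"
      by blast
    have "\<exists>R. inj_on R (I - J) \<and> (\<forall>i\<in>I - J. R i \<in> S i - ?U)"
    proof (rule less.hyps)
      show "card (I - J) < card I"
        using J tight(2) by (intro psubset_card_mono fin) blast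
      show "card K \<le> card (\<Union>i\<in>K. S i - ?U)" if K: "K \<subseteq> I - J" for K
      proof -
        \<comment> \<open>Hall's condition for the remaining indices follows from that for
          \<open>J \<union> K\<close> by subtracting the tight part.\<close>
        have "card (J \<union> K) \<le> card (\<Union>i\<in>J \<union> K. S i)"
          by (rule hall) (use J K in auto)
        also have "(\<Union>i\<in>J \<union> K. S i) = ?U \<union> (\<Union>i\<in>K. S i - ?U)"
          by blast
        also have "card \<dots> \<le> card ?U + card (\<Union>i\<in>K. S i - ?U)"
          by (rule card_Un_le)
        finally have "card (J \<union> K) \<le> card J + card (\<Union>i\<in>K. S i - ?U)"
          using tight(3) by simp
        moreover have "card (J \<union> K) = card J + card K"
          using K finJ0 fin by (intro card_Un_disjoint) (auto intro: finite_subset)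
        ultimately show ?thesis
          by simp
      qed
    qed (use fin finS in auto)
    then obtain R' where R': "inj_on R' (I - J)" "\<forall>i\<in>I - J. R' i \<in> S i - ?U"
      by blast
    let ?R = "\<lambda>i. if i \<in> J then R i else R' i"
    have "R i \<in> ?U" if "i \<in> J" for i
      using R(2) that by blast
    then have "R i \<noteq> R' k" if "i \<in> J" "k \<in> I - J" for i k
      using R'(2) that by fastforce
    then have "inj_on ?R I"
      using R(1) R'(1) unfolding inj_on_def by (metis DiffI)
    moreover have "\<forall>i\<in>I. ?R i \<in> S i"
      using R R' by auto
    ultimately show ?thesis
      by blast
  qed simp
qed

text \<open>Replacing every \<open>t\<close> by \<open>cap t\<close> copies reduces the claim to
  distinct representatives.\<close>

lemma hall_capacity:
  fixes cap :: "'b \<Rightarrow> nat"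
  assumes fin: "finite I" "\<And>i. i \<in> I \<Longrightarrow> finite (S i)"
    and hall: "\<And>J. J \<subseteq> I \<Longrightarrow> card J \<le> (\<Sum>t\<in>(\<Union>i\<in>J. S i). cap t)"
  shows "\<exists>g. (\<forall>i\<in>I. g i \<in> S i) \<and> (\<forall>t. card {i \<in> I. g i = t} \<le> cap t)"
proof -
  have "\<exists>R. inj_on R I \<and> (\<forall>i\<in>I. R i \<in> (SIGMA t:S i. {..<cap t}))"
  proof (rule hall_sdr)
    fix J assume J: "J \<subseteq> I"
    have "(\<Union>i\<in>J. SIGMA t:S i. {..<cap t}) = (SIGMA t:(\<Union>i\<in>J. S i). {..<cap t})"
      by blast
    moreover have "finite (\<Union>i\<in>J. S i)"
      using J fin finite_subset by blast
    ultimately show "card J \<le> card (\<Union>i\<in>J. SIGMA t:S i. {..<cap t})"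
      using hall[OF J] by (simp add: card_SigmaI)
  qed (use fin in auto)
  then obtain R where R: "inj_on R I" "\<forall>i\<in>I. R i \<in> (SIGMA t:S i. {..<cap t})"
    by blast
  have "card {i \<in> I. fst (R i) = t} \<le> cap t" for t
  proof -
    have "card {i \<in> I. fst (R i) = t} \<le> card ({t} \<times> {..<cap t})"
    proof (rule card_inj_on_le)
      show "inj_on R {i \<in> I. fst (R i) = t}"
        using R(1) by (rule inj_on_subset) auto
      show "R ` {i \<in> I. fst (R i) = t} \<subseteq> {t} \<times> {..<cap t}"
        using R(2) by auto
    qed simp
    then show ?thesis
      by (simp add: card_cartesian_product)
  qed
  moreover have "\<forall>i\<in>I. fst (R i) \<in> S i"
    using R(2) by auto
  ultimately show ?thesis
    by (intro exI[of _ "\<lambda>i. fst (R i)"]) auto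
qed

section \<open>Refined beads and their rounding\<close>

lemma card_blocks:
  fixes M :: nat
  assumes "0 < M" "J \<subseteq> {..<n}"
  shows "card {x. x < n * M \<and> x div M \<in> J} = card J * M"
proof -
  have "{x. x < n * M \<and> x div M \<in> J} = (\<lambda>(i, r). i * M + r) ` (J \<times> {..<M})"
  proof (intro equalityI subsetI)
    fix x assume "x \<in> {x. x < n * M \<and> x div M \<in> J}"
    then have "(x div M, x mod M) \<in> J \<times> {..<M}"
      using assms(1) by simp
    then show "x \<in> (\<lambda>(i, r). i * M + r) ` (J \<times> {..<M})"
      by (rule rev_image_eqI) simp
  next
    fix x assume "x \<in> (\<lambda>(i, r). i * M + r) ` (J \<times> {..<M})"
    then obtain i r where x: "x = i * M + r" "i \<in> J" "r < M"
      by auto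
    then have "Suc i \<le> n"
      using assms(2) by auto
    then have "Suc i * M \<le> n * M"
      by (rule mult_le_mono1)
    then show "x \<in> {x. x < n * M \<and> x div M \<in> J}"
      using x by simp
  qed
  moreover have "inj_on (\<lambda>(i, r). i * M + r) (J \<times> {..<M})"
  proof (rule inj_onI)
    fix u v assume uv: "u \<in> J \<times> {..<M}" "v \<in> J \<times> {..<M}"
      "(\<lambda>(i, r). i * M + r) u = (\<lambda>(i, r). i * M + r) v"
    obtain i r i' r' where "u = (i, r)" "v = (i', r')"
      by (cases u; cases v)
    moreover from this uv have "r < M" "r' < M" "i * M + r = i' * M + r'"
      by auto
    then have "(i * M + r) div M = (i' * M + r') div M" "(i * M + r) mod M = (i' * M + r') mod M"
      by simp_all
    ultimately show "u = v"
      using \<open>r < M\<close> \<open>r' < M\<close> by simp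
  qed
  ultimately show ?thesis
    by (simp add: card_image card_cartesian_product)
qed

text \<open>Consecutive samples with different values enclose a change of \<open>w\<close>. The
  intervals between consecutive samples do not overlap, so these changes are distinct.\<close>

lemma changes_sample:
  assumes x: "\<And>i. Suc i < n \<Longrightarrow> x i < x (Suc i)" "\<And>i. i < n \<Longrightarrow> x i < length w"
    and g: "\<And>i. i < n \<Longrightarrow> g i = w ! x i"
  shows "card {i. Suc i < n \<and> g i \<noteq> g (Suc i)} \<le> changes w"
proof -
  let ?G = "{i. Suc i < n \<and> g i \<noteq> g (Suc i)}"
  have "\<exists>y. x i \<le> y \<and> y < x (Suc i) \<and> w ! y \<noteq> w ! Suc y" if "i \<in> ?G" for i
  proof (rule ccontr)
    assume no: "\<not> ?thesis"
    have "w ! (x i + d) = w ! x i" if "x i + d \<le> x (Suc i)" for d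
      using that
    proof (induction d)
      case (Suc d)
      then have "w ! (x i + d) = w ! Suc (x i + d)"
        using no by (metis Suc_le_lessD add_Suc_right le_add1)
      then show ?case
        using Suc by simp
    qed simp
    from this[of "x (Suc i) - x i"] have "w ! x (Suc i) = w ! x i"
      using x(1) \<open>i \<in> ?G\<close> by (simp add: less_imp_le)
    then show False
      using \<open>i \<in> ?G\<close> g[of i] g[of "Suc i"] by simp
  qed
  then obtain y where y: "\<And>i. i \<in> ?G \<Longrightarrow> x i \<le> y i \<and> y i < x (Suc i) \<and> w ! y i \<noteq> w ! Suc (y i)"
    by metis
  have mono: "x (Suc i) \<le> x k" if "i < k" "k < n" for i k
    using that
  proof (induction k)
    case (Suc k)
    then show ?case
      using x(1)[of k] by (cases "i = k") auto
  qed simp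
  have less: "y i < y k" if "i \<in> ?G" "k \<in> ?G" "i < k" for i k
    using y[OF that(1)] y[OF that(2)] mono[OF that(3)] that(2) by auto
  have "inj_on y ?G"
  proof (rule inj_onI)
    show "i = k" if "i \<in> ?G" "k \<in> ?G" "y i = y k" for i k
      using less[OF that(1,2)] less[OF that(2,1)] that(3) by (cases i k rule: linorder_cases) simp_all
  qed
  moreover have "y ` ?G \<subseteq> {i. Suc i < length w \<and> w ! i \<noteq> w ! Suc i}"
  proof
    fix v assume "v \<in> y ` ?G"
    then obtain i where i: "i \<in> ?G" "v = y i"
      by blast
    then have "Suc v \<le> x (Suc i)" "x (Suc i) < length w"
      using y[OF i(1)] x(2)[of "Suc i"] by auto
    then show "v \<in> {i. Suc i < length w \<and> w ! i \<noteq> w ! Suc i}"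
      using y[OF i(1)] i(2) by auto
  qed
  moreover have "finite {i. Suc i < length w \<and> w ! i \<noteq> w ! Suc i}"
    by (rule finite_subset[of _ "{..<length w}"]) auto
  ultimately show ?thesis
    unfolding changes_def by (rule card_inj_on_le)
qed

text \<open>Each bead is refined into sufficiently many equal beads, so that the additive error of
  an approximate splitting is negligible; the capacities express the prescribed shares.\<close>

lemma exact_splitting:
  fixes xs :: "nat list" and cap :: "nat \<Rightarrow> nat \<Rightarrow> nat"
  assumes q: "1 \<le> q" and xs: "set xs \<subseteq> {1..m}"
    and cap: "\<And>j T k. j \<in> {1..m} \<Longrightarrow> T \<subseteq> {..<q} \<Longrightarrow> q * k \<le> card T * count_list xs j \<Longrightarrow> k \<le> (\<Sum>t\<in>T. cap j t)"
    and total: "\<And>j. j \<in> {1..m} \<Longrightarrow> (\<Sum>t<q. cap j t) = count_list xs j"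
  shows "\<exists>g. (\<forall>i<length xs. g i < q) \<and> card {i. Suc i < length xs \<and> g i \<noteq> g (Suc i)} \<le> (q - 1) * m \<and>
    (\<forall>j\<in>{1..m}. \<forall>t<q. card {i. i < length xs \<and> xs ! i = j \<and> g i = t} = cap j t)"
proof -
  define n where "n = length xs"
  obtain c where c: "\<And>xs. set xs \<subseteq> {1..m} \<Longrightarrow> \<exists>w\<in>words q (length xs). changes w \<le> (q - 1) * m \<and>
       (\<forall>j\<in>{1..m}. \<forall>s<q. q * count_list (zip xs w) (j, s) \<le> count_list xs j + c)"
    using splittable[OF q] unfolding splittable_def by blast
  \<comment> \<open>The errors of at most \<open>q\<close> thieves add up to at most
    \<open>q * c\<close>, fewer than the \<open>M\<close> pieces of a single bead.\<close>
  define M where "M = Suc (q * c)"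
  have M: "0 < M"
    unfolding M_def by simp
  have div_less: "x div M < n" if "x < n * M" for x
    using that M by (simp add: div_less_iff_less_mult)
  define ys where "ys = map (\<lambda>x. xs ! (x div M)) [0..<n * M]"
  have len_ys: "length ys = n * M" and nth_ys: "x < n * M \<Longrightarrow> ys ! x = xs ! (x div M)" for x
    unfolding ys_def by simp_all
  have "set ys \<subseteq> {1..m}"
    unfolding ys_def using xs div_less n_def by (auto simp: subset_iff)
  then obtain w where w: "w \<in> words q (n * M)" "changes w \<le> (q - 1) * m"
    "\<And>j s. j \<in> {1..m} \<Longrightarrow> s < q \<Longrightarrow> q * count_list (zip ys w) (j, s) \<le> count_list ys j + c"
    using c[of ys] len_ys by auto
  have len_w: "length w = length ys"
    using w(1) len_ys length_words by simp
  define B where "B = (\<lambda>j. {i. i < n \<and> xs ! i = j})"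
  have B: "B j \<subseteq> {..<n}" "finite (B j)" "card (B j) = count_list xs j" for j
    unfolding B_def n_def count_list_card by auto
  have count_ys: "count_list ys j = count_list xs j * M" for j
  proof -
    have "count_list ys j = card {x. x < n * M \<and> x div M \<in> B j}"
      unfolding count_list_card by (intro arg_cong[of _ _ card] Collect_cong)
        (auto simp: len_ys nth_ys B_def div_less)
    then show ?thesis
      using card_blocks[OF M B(1)] B(3) by simp
  qed
  \<comment> \<open>The thieves who get some piece of bead \<open>i\<close>. Giving the bead to one
    of them makes the final assignment a sample of \<open>w\<close>.\<close>
  define S where "S = (\<lambda>i. {w ! x |x. x < n * M \<and> x div M = i})"
  have S_sub: "S i \<subseteq> {..<q}" for i
    unfolding S_def using nth_words[OF w(1)] by auto
  have "\<exists>g. (\<forall>i\<in>B j. g i \<in> S i) \<and> (\<forall>t. card {i \<in> B j. g i = t} \<le> cap j t)" if j: "j \<in> {1..m}" for j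
  proof (rule hall_capacity)
    show "finite (S i)" for i
      using S_sub finite_subset by blast
    fix J assume J: "J \<subseteq> B j"
    let ?T = "\<Union>i\<in>J. S i"
    have T: "?T \<subseteq> {..<q}" "finite ?T"
      using S_sub finite_subset[of ?T "{..<q}"] by blast+
    \<comment> \<open>Hall's condition: all pieces of the beads in \<open>J\<close> go to thieves in
      \<open>?T\<close>, each of whom has at most slightly more than a \<open>q\<close>-th of the
      pieces of color \<open>j\<close>. Comparison after division by \<open>M\<close> removes the
      error.\<close>
    have "card J * M = card {x. x < n * M \<and> x div M \<in> J}"
      using card_blocks[OF M, of J n] J B(1) by (simp add: subset_trans)
    also have "\<dots> \<le> card (\<Union>t\<in>?T. {x. x < length ys \<and> ys ! x = j \<and> w ! x = t})"
    proof (rule card_mono)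
      show "finite (\<Union>t\<in>?T. {x. x < length ys \<and> ys ! x = j \<and> w ! x = t})"
        by (rule finite_subset[of _ "{..<length ys}"]) auto
      show "{x. x < n * M \<and> x div M \<in> J} \<subseteq> (\<Union>t\<in>?T. {x. x < length ys \<and> ys ! x = j \<and> w ! x = t})"
        using J nth_ys unfolding len_ys B_def S_def by blast
    qed
    also have "\<dots> \<le> (\<Sum>t\<in>?T. card {x. x < length ys \<and> ys ! x = j \<and> w ! x = t})"
      by (rule card_UN_le) (rule T(2))
    also have "\<dots> = (\<Sum>t\<in>?T. count_list (zip ys w) (j, t))"
      by (simp add: count_zip_card[OF len_w])
    finally have "q * (card J * M) \<le> (\<Sum>t\<in>?T. q * count_list (zip ys w) (j, t))"
      by (simp flip: sum_distrib_left)
    also have "\<dots> \<le> (\<Sum>t\<in>?T. count_list xs j * M + c)"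
      using w(3)[OF j] T(1) by (intro sum_mono) (auto simp: count_ys)
    also have "\<dots> = card ?T * count_list xs j * M + card ?T * c"
      by (simp add: algebra_simps)
    also have "card ?T \<le> q"
      using card_mono[OF _ T(1)] by simp
    then have "card ?T * c < M"
      unfolding M_def by (simp add: less_Suc_eq_le)
    finally have "q * card J * M < (card ?T * count_list xs j + 1) * M"
      by (simp add: algebra_simps)
    then have "q * card J < card ?T * count_list xs j + 1"
      using mult_less_cancel2 by blast
    then show "card J \<le> (\<Sum>t\<in>?T. cap j t)"
      by (intro cap[OF j T(1)]) simp
  qed (rule B)
  then obtain h where h: "\<And>j i. j \<in> {1..m} \<Longrightarrow> i \<in> B j \<Longrightarrow> h j i \<in> S i"
    "\<And>j t. j \<in> {1..m} \<Longrightarrow> card {i \<in> B j. h j i = t} \<le> cap j t"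
    by metis
  define g where "g = (\<lambda>i. h (xs ! i) i)"
  have g_S: "g i \<in> S i" if "i < n" for i
    unfolding g_def
  proof (rule h(1))
    show "xs ! i \<in> {1..m}"
      using that xs nth_mem unfolding n_def by blast
  qed (use that in \<open>simp add: B_def\<close>)
  have g_less: "g i < q" if "i < n" for i
    using g_S[OF that] S_sub by blast
  have "\<forall>i. \<exists>x. i < n \<longrightarrow> x < n * M \<and> x div M = i \<and> g i = w ! x"
    using g_S unfolding S_def by fastforce
  \<comment> \<open>One piece of each bead that \<open>w\<close> gives to the thief chosen for the
    bead. These positions increase with the bead, as sampling requires.\<close>
  then obtain x where x: "\<And>i. i < n \<Longrightarrow> x i < n * M \<and> x i div M = i \<and> g i = w ! x i"
    by metis
  have "card {i. Suc i < n \<and> g i \<noteq> g (Suc i)} \<le> changes w"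
  proof (rule changes_sample)
    fix i assume i: "Suc i < n"
    show "x i < x (Suc i)"
    proof (rule ccontr)
      assume "\<not> x i < x (Suc i)"
      then have "x (Suc i) div M \<le> x i div M"
        by (intro div_le_mono) simp
      then show False
        using x[of i] x[OF i] i by simp
    qed
  qed (use x len_w len_ys in auto)
  moreover have "card {i. i < n \<and> xs ! i = j \<and> g i = t} = cap j t" if j: "j \<in> {1..m}" and t: "t < q" for j t
  proof -
    let ?r = "\<lambda>t. card {i \<in> B j. h j i = t}"
    \<comment> \<open>Both sides of \<open>?r t \<le> cap j t\<close> have the same sum over all
      thieves, which forces equality for each of them.\<close>
    have "sum ?r {..<q} = card (B j)"
    proof -
      have sub: "h j ` B j \<subseteq> {..<q}"
        using h(1)[OF j] S_sub by blast
      then show ?thesis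
        using sum.group[OF B(2) _ sub, of "\<lambda>_. 1::nat"] by simp
    qed
    also have "\<dots> = sum (cap j) {..<q}"
      using total[OF j] B(3) by simp
    finally have "?r t = cap j t"
      by (rule sum_mono_inv) (use h(2)[OF j] t in auto)
    moreover have "{i. i < n \<and> xs ! i = j \<and> g i = t} = {i \<in> B j. h j i = t}"
      unfolding B_def g_def by auto
    ultimately show ?thesis
      by simp
  qed
  ultimately show ?thesis
    using g_less w(2) unfolding n_def by (intro exI[of _ g]) auto
qed

section \<open>From assignments of beads to cuts\<close>

lemma cuts_of_assignment:
  fixes g :: "nat \<Rightarrow> nat" and xs :: "nat list"
  assumes q: "1 \<le> q" and g: "\<And>i. i < length xs \<Longrightarrow> g i \<in> {1..q}"
  shows "\<exists>C f. splitting q xs C f \<and> card C = card {i. Suc i < length xs \<and> g i \<noteq> g (Suc i)} \<and>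
    (\<forall>t j. received xs C f t j = card {i. i < length xs \<and> xs ! i = j \<and> g i = t})"
proof -
  define C where "C = Suc ` {i. Suc i < length xs \<and> g i \<noteq> g (Suc i)}"
  define idx where "idx = (\<lambda>i. card {p \<in> C. p \<le> i})"
  \<comment> \<open>The default 1 covers indices without beads: on the empty necklace
    \<open>splitting\<close> still asks for a thief in \<open>{1..q}\<close> at index 0.\<close>
  define f where "f = (\<lambda>k. if \<exists>i<length xs. idx i = k then g (SOME i. i < length xs \<and> idx i = k) else 1)"
  have C_sub: "C \<subseteq> {1..<length xs}"
    unfolding C_def by auto
  then have fin: "finite C"
    using finite_subset by blast
  have step: "g i = g (Suc i)" if "Suc i < length xs" "idx i = idx (Suc i)" for i
  proof (rule ccontr)
    assume "g i \<noteq> g (Suc i)"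
    then have "Suc i \<in> C"
      unfolding C_def using that by auto
    then have "{p \<in> C. p \<le> Suc i} = insert (Suc i) {p \<in> C. p \<le> i}"
      by (auto simp: le_Suc_eq)
    then have "idx (Suc i) = Suc (idx i)"
      unfolding idx_def using fin by simp
    then show False
      using that by simp
  qed
  have idx_mono: "idx i \<le> idx k" if "i \<le> k" for i k
    unfolding idx_def using fin that by (intro card_mono) auto
  have const: "g i = g (i + d)" if "i + d < length xs" "idx i = idx (i + d)" for i d
    using that
  proof (induction d)
    case (Suc d)
    then have "idx i = idx (i + d)" "idx (i + d) = idx (Suc (i + d))"
      using idx_mono[of i "i + d"] idx_mono[of "i + d" "Suc (i + d)"] by auto
    then show ?case
      using Suc step[of "i + d"] by simp
  qed simp
  have same: "g i = g k" if "i < length xs" "k < length xs" "idx i = idx k" for i k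
  proof (cases "i \<le> k")
    case True
    then show ?thesis
      using const[of i "k - i"] that by simp
  next
    case False
    then show ?thesis
      using const[of k "i - k"] that by simp
  qed
  have f_idx: "f (idx i) = g i" if i: "i < length xs" for i
  proof -
    have ex: "\<exists>k<length xs. idx k = idx i"
      using i by blast
    then have some: "(SOME k. k < length xs \<and> idx k = idx i) < length xs \<and>
        idx (SOME k. k < length xs \<and> idx k = idx i) = idx i"
      by (rule someI_ex)
    show ?thesis
      unfolding f_def if_P[OF ex] by (rule same[OF conjunct1[OF some] i conjunct2[OF some]])
  qed
  have "f k \<in> {1..q}" for k
  proof (cases "\<exists>i<length xs. idx i = k")
    case True
    then show ?thesis
      using f_idx g by auto
  next
    case False
    then show ?thesis
      unfolding f_def if_not_P[OF False] using q by simp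
  qed
  then have "splitting q xs C f"
    unfolding splitting_def using C_sub by simp
  moreover have "card C = card {i. Suc i < length xs \<and> g i \<noteq> g (Suc i)}"
    unfolding C_def by (rule card_image) simp
  moreover have "beads_received xs C f t = {i. i < length xs \<and> g i = t}" for t
  proof -
    have "idx i \<le> card C" for i
      unfolding idx_def using fin by (intro card_mono) auto
    moreover have "card {p \<in> C. p \<le> i} = idx i" for i
      unfolding idx_def ..
    ultimately show ?thesis
      unfolding beads_received_def cut_interval_def by (auto simp: f_idx)
  qed
  then have "received xs C f t j = card {i. i < length xs \<and> xs ! i = j \<and> g i = t}" for t j
    unfolding received_def by (intro arg_cong[of _ _ card]) auto
  ultimately show ?thesis
    by blast
qed

section \<open>Prescribed shares and the final count\<close>

lemma ceiling_div_nat: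
  assumes "0 < q"
  shows "\<lceil>real a / real q\<rceil> = int (a div q + (if a mod q = 0 then 0 else 1))"
proof -
  have "real a / real q = real (a div q) \<longleftrightarrow> a mod q = 0"
  proof
    assume "real a / real q = real (a div q)"
    then have "real a = real (a div q * q)"
      using assms by (simp add: field_simps)
    then have "a = a div q * q"
      unfolding of_nat_eq_iff .
    then show "a mod q = 0"
      by (metis mod_mult_self2_is_0)
  next
    assume "a mod q = 0"
    then show "real a / real q = real (a div q)"
      by (simp add: real_of_nat_div mod_eq_0_iff_dvd)
  qed
  then show ?thesis
    unfolding ceiling_altdef floor_divide_of_nat_eq by (simp only: of_int_of_nat_eq) auto
qed

text \<open>Splitting off the quotient reduces the claim to
  \<open>card T * (a mod q) < q * Suc (card (T \<inter> A))\<close>. This holds if \<open>T\<close>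
  contains all thieves, and for smaller \<open>T\<close> it is where the three admissible remainders
  enter.\<close>

lemma share_capacity:
  fixes q k a :: nat and A T :: "nat set"
  assumes q: "1 \<le> q" and A: "A \<subseteq> {..<q}" "card A = a mod q" and r: "a mod q \<in> {0, 1, q - 1}"
    and T: "T \<subseteq> {..<q}" and k: "q * k \<le> card T * a"
  shows "k \<le> (\<Sum>t\<in>T. a div q + (if t \<in> A then 1 else 0))"
proof -
  have finT: "finite T" and finA: "finite A"
    using T A(1) finite_subset by blast+
  have cardT: "card T \<le> q"
    using card_mono[OF _ T] by simp
  define d where "d = a div q"
  have sum: "(\<Sum>t\<in>T. d + (if t \<in> A then 1 else 0)) = card T * d + card (T \<inter> A)"
    using finT by (simp add: sum.distrib sum.If_cases Int_def)
  have "q * k \<le> card T * (q * d + a mod q)"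
    using k unfolding d_def by simp
  also have "card T * (q * d + a mod q) = q * (card T * d) + card T * (a mod q)"
    by (simp add: algebra_simps)
  finally have bound: "q * k \<le> q * (card T * d) + card T * (a mod q)" .
  have "card T * (a mod q) < q * Suc (card (T \<inter> A))"
  proof (cases "T = {..<q}")
    case True
    then have "card (T \<inter> A) = a mod q" "card T = q"
      using A by (simp_all add: Int_absorb1)
    then show ?thesis
      using q by simp
  next
    case False
    then have less: "card T < q"
      using psubset_card_mono[of "{..<q}" T] T by auto
    consider "a mod q = 0" | "a mod q = 1" | "a mod q = q - 1"
      using r by auto
    then show ?thesis
    proof cases
      case 3
      \<comment> \<open>For remainder \<open>q - 1\<close> a single thief lies outside
        \<open>A\<close>, so \<open>T\<close> has at most one member there.\<close>
      have "card (T - A) \<le> card ({..<q} - A)"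
        using T by (intro card_mono) auto
      also have "\<dots> = 1"
        using A 3 q finA by (simp add: card_Diff_subset)
      finally have "card T \<le> Suc (card (T \<inter> A))"
        using card_Int_Diff[OF finT, of A] by simp
      then have "card T * (q - 1) \<le> Suc (card (T \<inter> A)) * (q - 1)"
        by (rule mult_le_mono1)
      also have "\<dots> < Suc (card (T \<inter> A)) * q"
        by (rule mult_less_mono2) (use q in simp_all)
      finally show ?thesis
        using 3 by (simp add: mult.commute)
    qed (use less q in auto)
  qed
  with bound have "q * k < q * (card T * d + Suc (card (T \<inter> A)))"
    unfolding distrib_left by linarith
  then have "k < card T * d + Suc (card (T \<inter> A))"
    using mult_less_cancel1 by blast
  then show ?thesis
    using sum unfolding d_def by simp
qed

theorem theorem2:
  fixes q n m :: nat and xs :: "nat list" and a r :: "nat \<Rightarrow> nat" and A :: "nat \<Rightarrow> nat set"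
  assumes "q \<ge> 1"
    and "length xs = n"
    and "set xs \<subseteq> {1..m}"
    and "\<And>j. j \<in> {1..m} \<Longrightarrow> a j = count_list xs j"
    and "\<And>j. j \<in> {1..m} \<Longrightarrow> r j = a j mod q"
    and "\<And>j. j \<in> {1..m} \<Longrightarrow> r j \<in> {0, 1, q - 1}"
    and "\<And>j. j \<in> {1..m} \<Longrightarrow> r j \<noteq> 0 \<Longrightarrow> A j \<subseteq> {1..q} \<and> card (A j) = r j"
  shows "\<exists>C f. fair_splitting q m xs C f \<and> card C \<le> (q - 1) * m \<and>
    (\<forall>j \<in> {1..m}. r j \<noteq> 0 \<longrightarrow>
      (\<forall>t \<in> {1..q}.
        (t \<in> A j \<longrightarrow> int (received xs C f t j) = \<lceil>real (a j) / real q\<rceil>) \<and>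
        (t \<notin> A j \<longrightarrow> int (received xs C f t j) = \<lfloor>real (a j) / real q\<rfloor>)))"
proof -
  \<comment> \<open>Thieves are renumbered from 0. For remainder 0 the favored set is taken to be
    empty, so that its cardinality is the remainder in every case.\<close>
  define A' where "A' = (\<lambda>j. if r j = 0 then {} else {t. Suc t \<in> A j})"
  have A': "A' j \<subseteq> {..<q}" "card (A' j) = a j mod q" if j: "j \<in> {1..m}" for j
  proof -
    have "A j = Suc ` {t. Suc t \<in> A j}" if "r j \<noteq> 0"
    proof -
      have "A j \<subseteq> {1..q}"
        using assms(7)[OF j that] by blast
      then show ?thesis
        by (auto simp: image_iff subset_iff) (metis Suc_pred' less_eq_Suc_le One_nat_def)
    qed
    then have "card {t. Suc t \<in> A j} = r j" if "r j \<noteq> 0"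
      using assms(7)[OF j that] that by (metis card_image inj_Suc)
    then show "card (A' j) = a j mod q"
      unfolding A'_def assms(5)[OF j, symmetric] by simp
    show "A' j \<subseteq> {..<q}"
      unfolding A'_def using assms(7)[OF j] by (auto simp: subset_iff less_eq_Suc_le)
  qed
  define cap where "cap = (\<lambda>j t. a j div q + (if t \<in> A' j then 1 else 0))"
  have "\<exists>g. (\<forall>i<length xs. g i < q) \<and> card {i. Suc i < length xs \<and> g i \<noteq> g (Suc i)} \<le> (q - 1) * m \<and>
    (\<forall>j\<in>{1..m}. \<forall>t<q. card {i. i < length xs \<and> xs ! i = j \<and> g i = t} = cap j t)"
  proof (rule exact_splitting[OF assms(1,3)])
    fix j assume j: "j \<in> {1..m}"
    show "k \<le> (\<Sum>t\<in>T. cap j t)" if "T \<subseteq> {..<q}" "q * k \<le> card T * count_list xs j" for T k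
      unfolding cap_def
      using A'[OF j] assms(4-6)[OF j] that by (intro share_capacity[OF assms(1)]) auto
    have "(\<Sum>t<q. cap j t) = q * (a j div q) + card ({..<q} \<inter> A' j)"
      unfolding cap_def by (simp add: sum.distrib sum.If_cases Int_def)
    also have "{..<q} \<inter> A' j = A' j"
      using A'(1)[OF j] by blast
    finally show "(\<Sum>t<q. cap j t) = count_list xs j"
      using A'(2)[OF j] assms(4)[OF j] by simp
  qed
  then obtain g where g: "\<And>i. i < length xs \<Longrightarrow> g i < q"
    "card {i. Suc i < length xs \<and> g i \<noteq> g (Suc i)} \<le> (q - 1) * m"
    "\<And>j t. j \<in> {1..m} \<Longrightarrow> t < q \<Longrightarrow> card {i. i < length xs \<and> xs ! i = j \<and> g i = t} = cap j t"
    by blast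
  have "Suc (g i) \<in> {1..q}" if "i < length xs" for i
    using g(1)[OF that] by simp
  then obtain C f where Cf: "splitting q xs C f"
    "card C = card {i. Suc i < length xs \<and> Suc (g i) \<noteq> Suc (g (Suc i))}"
    "\<And>t j. received xs C f t j = card {i. i < length xs \<and> xs ! i = j \<and> Suc (g i) = t}"
    using cuts_of_assignment[OF assms(1), of xs "\<lambda>i. Suc (g i)"] by blast
  have received: "received xs C f t j = a j div q + (if r j \<noteq> 0 \<and> t \<in> A j then 1 else 0)"
    if j: "j \<in> {1..m}" and t: "t \<in> {1..q}" for j t
  proof -
    obtain s where s: "t = Suc s" "s < q"
      using t by (cases t) auto
    then show ?thesis
      using g(3)[OF j s(2)] Cf(3)[of t j] unfolding cap_def A'_def by auto
  qed
  have floor: "\<lfloor>real (a j) / real q\<rfloor> = int (a j div q)" for j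
    by (rule floor_divide_of_nat_eq)
  have ceiling: "\<lceil>real (a j) / real q\<rceil> = int (a j div q + (if r j = 0 then 0 else 1))" if "j \<in> {1..m}" for j
    using ceiling_div_nat[of q "a j"] assms(1) assms(5)[OF that] by simp
  have "fair_splitting q m xs C f"
    unfolding fair_splitting_def using Cf(1) assms(4)[symmetric] received floor ceiling by auto
  moreover have "card C \<le> (q - 1) * m"
    using Cf(2) g(2) by simp
  ultimately show ?thesis
    using received floor ceiling by (intro exI[of _ C] exI[of _ f]) auto
qed

end
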